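(* For an integer $k\ge 0$ and complex $z$ define $\mathscr S_k(z)=\sum_{n=0}^{\infty}\frac{z^n}{(2n+1)^k\binom{2n}{n}}$ (whenever the series converges). Then: (a) For integers $k\ge2$, $N\ge3$ and any integer $m$, \[ \mathscr S_k\Bigl(4\sin^2\frac{2m\pi}{N}\Bigr)\sin\frac{2m\pi}{N}\in i\,\mathfrak Z_k(\operatorname{lcm}(2,N)). \] (b) For every integer $k\ge2$: $\mathscr S_k(-9/4)\in\mathfrak Z_k(6)$; $\mathscr S_k(-4)\in\mathfrak Z_k(8)$; $\sqrt2\,\mathscr S_k(-1/2)\in\mathfrak Z_k(8)$; $\mathscr S_k(-1)\in\mathfrak Z_k(10)$; $\sqrt5\,\mathscr S_k(-16/5)\in\mathfrak Z_k(10)$; $\sqrt3\,\mathscr S_k(-4/3)\in\mathfrak Z_k(12)$.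
   Context: For positive integers $s_1,\dots,s_m$ and complex $z_1,\dots,z_m$, $\operatorname{Li}_{s_1,\dots,s_m}(z_1,\dots,z_m)=\sum_{n_1>\cdots>n_m\ge1} \frac{z_1^{n_1}\cdots z_m^{n_m}}{n_1^{s_1}\cdots n_m^{s_m}}$ (when convergent). For positive integers $k,N$, $\mathfrak Z_k(N)$ is the $\mathbb Q$-linear span of all $\operatorname{Li}_{s_1,\dots,s_m}(z_1,\dots,z_m)$ with $s_j\in\mathbb Z_{>0}$, $\sum_j s_j=k$, $z_j^N=1$ for all $j$, and $(s_1,z_1)\neq(1,1)$ (cyclotomic multiple zeta values of weight $k$ and level $N$); $\mathfrak Z_0(N)=\mathbb Q$. $i\,\mathfrak Z_k(M)=\{ix:x\in\mathfrak Z_k(M)\}$, and $\operatorname{lcm}(a,b)$ is the least common multiple. *)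

theory Defs
  imports "HOL-Analysis.Analysis"
begin

fun Li_partial :: "nat list \<Rightarrow> complex list \<Rightarrow> nat \<Rightarrow> complex" where
  "Li_partial [] [] M = 1"
| "Li_partial (s # ss) (z # zs) M =
     (\<Sum>n = 1..M. z ^ n / of_nat n ^ s * Li_partial ss zs (n - 1))"
| "Li_partial _ _ M = 0"

definition Li :: "nat list \<Rightarrow> complex list \<Rightarrow> complex" where
  "Li s z = lim (\<lambda>M. Li_partial s z M)"

definition CMZV_gens :: "nat \<Rightarrow> nat \<Rightarrow> complex set" where
  "CMZV_gens k N = {Li s z | s z. length s = length z \<and> s \<noteq> [] \<and>
      (\<forall>j \<in> set s. j > 0) \<and> sum_list s = k \<and>
      (\<forall>w \<in> set z. w ^ N = 1) \<and> \<not> (hd s = 1 \<and> hd z = 1)}"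

definition CMZV :: "nat \<Rightarrow> nat \<Rightarrow> complex set" where
  "CMZV k N = (if k = 0 then {of_rat q | q. True} else
     {x. \<exists>n (c :: nat \<Rightarrow> rat) v. (\<forall>i<n. v i \<in> CMZV_gens k N) \<and>
          x = (\<Sum>i<n. of_rat (c i) * v i)})"

definition S_series :: "nat \<Rightarrow> complex \<Rightarrow> complex" where
  "S_series k z = (\<Sum>n. z ^ n / (of_nat (2 * n + 1) ^ k * of_nat ((2 * n) choose n)))"

end

theory Submission
  imports Defs
begin

text \<open>Put \<open>h(w) = (w - 1/w) / 2\<close>. The functions \<open>e\<^sub>k(w) = h(w) S\<^sub>k(- 4 h(w)\<^sup>2)\<close> (with \<open>e\<^sub>1\<close> replaced by
  \<open>Ln w\<close> and \<open>e\<^sub>0 = 1\<close>) form a chain of iterated integrals based at \<open>w = 1\<close> of \<open>dw/w\<close>,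
  then \<open>dw/(w - 1) - dw/(w + 1)\<close>, then \<open>dw/(w - 1) + dw/(w + 1) - dw/w\<close> repeatedly; the start of the
  chain is the classical expansion of \<open>arcsin x / sqrt (1 - x\<^sup>2)\<close>.
  Reversing the chain, \<open>e\<^sub>k(w\<^sub>0)\<close> is up to sign an iterated integral from \<open>w\<^sub>0\<close> to \<open>1\<close>. In this direction no
  regularisation is needed: \<open>w\<^sub>0\<close> is not a pole of any form and \<open>1\<close> is not a pole of the last
  form \<open>dw/w\<close>. After a Moebius change of variable that sends \<open>w\<^sub>0\<close>, \<open>1\<close>, \<open>- 1\<close> (and, except when
  \<open>\<bar>w\<^sub>0\<bar> = 1\<close>, also \<open>0\<close> and \<open>\<infinity>\<close>) to roots of unity, the reversed integrals are combinations of powers of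
  the logarithm and multiple polylogarithms with coefficients in the algebra of cyclotomic multiple zeta
  values, so their boundary values lie in that algebra.\<close>

section \<open>Coefficients of multiple polylogarithms\<close>

text \<open>The chain rests on one identity: multiplying the n-th coefficient by 2n + 1 lowers k,
  and in the variable y with argument -4 y^2 this is y d/dy acting on y S_k(-4 y^2). For y = h(w),
  dy/y is the form that repeats. At the bottom, h S_1 equals Ln w divided by (w + 1/w)/2; this
  factor would bring in poles at the square roots of -1, but it cancels against dy, which is why Ln
  w stands in for e_1. The obstacle is the end point 1, a pole of every form except dw/w: the
  incomplete reversed integrals may blow up there. In the reversal formula they are multiplied by
  some e_j, which vanishes at 1 to first order, so a growth of o(1 / (1 - |u|)) is harmless as long
  as the path does not become tangent to the unit circle. The path must also stay in |h| < 1, where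
  the series is differentiated; its starting point may satisfy |h| = 1. Closure of the values under
  products is needed because each primitive is normalised to vanish at the image of the starting
  point, and the constants so introduced multiply the later polylogarithms.\<close>

fun Li_coeff :: "(nat \<times> complex) list \<Rightarrow> nat \<Rightarrow> complex" where
  "Li_coeff [] n = (if n = 0 then 1 else 0)"
| "Li_coeff ((s, z) # v) n = z ^ n / of_nat n ^ s * (\<Sum>j<n. Li_coeff v j)"

definition weight :: "(nat \<times> complex) list \<Rightarrow> nat" where
  "weight w = sum_list (map fst w)"

definition root_word :: "nat \<Rightarrow> (nat \<times> complex) list \<Rightarrow> bool" where
  "root_word N w \<longleftrightarrow> (\<forall>(s, z) \<in> set w. 0 < s \<and> z ^ N = 1)"

definition convergent_word :: "(nat \<times> complex) list \<Rightarrow> bool" where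
  "convergent_word w \<longleftrightarrow> w = [] \<or> hd w \<noteq> (1, 1)"

lemma weight_simps [simp]: "weight [] = 0" "weight ((s, z) # w) = s + weight w"
  by (simp_all add: weight_def)

lemma root_word_simps [simp]: "root_word N []" "root_word N ((s, z) # w) \<longleftrightarrow> 0 < s \<and> z ^ N = 1 \<and> root_word N w"
  by (auto simp: root_word_def)

text \<open>The empty word sits at index 0, so its partial sum below n is 1 exactly when n is
  positive. This encodes the condition that the smallest summation index be at least 1.\<close>

lemma sum_Li_coeff_Nil: "(\<Sum>j<n. Li_coeff [] j) = (if n = 0 then 0 else 1)"
proof (cases n)
  case (Suc m)
  have "(\<Sum>j<n. Li_coeff [] j) = (\<Sum>j\<in>{0}. Li_coeff [] j)"
    by (rule sum.mono_neutral_right) (auto simp: Suc)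
  then show ?thesis by (simp add: Suc)
qed simp

lemma sum_lessThan_le_pred: "0 < n \<Longrightarrow> (\<Sum>j<n. f j) = (\<Sum>j\<le>n - 1. f j)" for n :: nat
  by (metis Suc_pred' lessThan_Suc_atMost)

lemma Li_partial_eq:
  "length s = length z \<Longrightarrow> Li_partial s z M = (\<Sum>n\<le>M. Li_coeff (zip s z) n)"
proof (induction s z M rule: Li_partial.induct)
  case (1 M)
  show ?case using sum_Li_coeff_Nil[of "Suc M"] by (simp add: lessThan_Suc_atMost)
next
  case (2 s ss z zs M)
  have "(\<Sum>n\<le>M. Li_coeff (zip (s # ss) (z # zs)) n) = (\<Sum>n = 1..M. Li_coeff (zip (s # ss) (z # zs)) n)"
    by (rule sum.mono_neutral_right) (auto simp: not_le)
  also have "\<dots> = Li_partial (s # ss) (z # zs) M"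
    using 2 by (auto simp: sum_lessThan_le_pred intro!: sum.cong)
  finally show ?case by simp
qed auto

lemma root_unity_norm: "N > 0 \<Longrightarrow> z ^ N = 1 \<Longrightarrow> norm z = 1" for z :: complex
  by (metis norm_one norm_power norm_ge_zero power_eq_1_iff not_gr_zero)

text \<open>The partial sums grow at most like a power of log n. The square root is a cruder bound
  that a single induction can carry: dividing by n leaves 1 / sqrt n, which is at most 4 times sqrt
  (n + 1) - sqrt n, and these differences telescope.\<close>

lemma Li_coeff_sum_bound:
  assumes "N > 0" "root_word N w"
  shows "\<exists>C\<ge>0. \<forall>n. norm (\<Sum>j<n. Li_coeff w j) \<le> C * sqrt n"
  using assms(2)
proof (induction w)
  case Nil
  have "norm (\<Sum>j<n. Li_coeff [] j) \<le> 1 * sqrt n" for n by (simp add: sum_Li_coeff_Nil)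
  then show ?case by (intro exI[of _ 1]) auto
next
  case (Cons a v)
  obtain s z where a: "a = (s, z)" by (cases a)
  with Cons obtain C where C: "C \<ge> 0" "\<And>n. norm (\<Sum>j<n. Li_coeff v j) \<le> C * sqrt n"
    and s: "s > 0" and z: "z ^ N = 1" by auto
  have z1: "norm z = 1"
    using root_unity_norm[OF \<open>N > 0\<close> z] .
  have b: "norm (Li_coeff (a # v) n) \<le> 2 * C * (sqrt (Suc n) - sqrt n) * 2" for n
  proof (cases "n = 0")
    case True
    then show ?thesis using C(1) by (simp add: a)
  next
    case False
    have "norm (Li_coeff (a # v) n) = norm (\<Sum>j<n. Li_coeff v j) / real n ^ s"
      by (simp add: a norm_mult norm_divide norm_power z1)
    also have "\<dots> \<le> C * sqrt n / real n ^ 1"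
      using s False C by (intro frac_le C(2) power_increasing) auto
    also have "\<dots> = C / sqrt n"
      using False by (simp add: field_simps)
    also have "1 / sqrt n \<le> 4 * (sqrt (Suc n) - sqrt n)"
    proof -
      have "sqrt (Suc n) \<le> sqrt (4 * n)" using False by (subst real_sqrt_le_iff) auto
      then have le: "sqrt (Suc n) \<le> 2 * sqrt n" by (simp add: real_sqrt_mult)
      have p: "sqrt n > 0" "sqrt (Suc n) > 0" using False by auto
      have "(sqrt (Suc n) - sqrt n) * (sqrt (Suc n) + sqrt n) = 1"
        by (simp add: algebra_simps)
      then have "sqrt (Suc n) - sqrt n = 1 / (sqrt (Suc n) + sqrt n)"
        using p by (metis add_pos_pos less_numeral_extra(3) nonzero_eq_divide_eq)
      also have "\<dots> \<ge> 1 / (4 * sqrt n)"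
      proof (intro divide_left_mono mult_pos_pos add_pos_pos p)
        show "sqrt (Suc n) + sqrt n \<le> 4 * sqrt n" using le p by linarith
      qed (use p in auto)
      finally show ?thesis using p by (simp add: field_simps)
    qed
    then have "C / sqrt n \<le> C * (4 * (sqrt (Suc n) - sqrt n))"
      using C(1) by (metis mult_left_mono times_divide_eq_right mult.right_neutral)
    finally show ?thesis by (simp add: algebra_simps)
  qed
  have "norm (\<Sum>j<n. Li_coeff (a # v) j) \<le> (4 * C) * sqrt n" for n
  proof -
    have "norm (\<Sum>j<n. Li_coeff (a # v) j) \<le> (\<Sum>j<n. 2 * C * (sqrt (Suc j) - sqrt j) * 2)"
      by (rule sum_norm_le) (use b in auto)
    also have "\<dots> = 4 * C * (\<Sum>j<n. (sqrt (Suc j) - sqrt j))"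
      by (simp add: sum_distrib_left sum_distrib_right algebra_simps)
    also have "(\<Sum>j<n. (sqrt (Suc j) - sqrt j)) = sqrt n"
      by (subst sum_lessThan_telescope) auto
    finally show ?thesis .
  qed
  then show ?case using C(1) by (intro exI[of _ "4 * C"]) auto
qed

lemma Li_coeff_bound:
  assumes "N > 0" "root_word N ((s, z) # v)"
  obtains C where "C \<ge> 0" "\<And>n. norm (Li_coeff ((s, z) # v) n) \<le> C * sqrt n / real n ^ s"
proof -
  obtain C where C: "C \<ge> 0" "\<And>n. norm (\<Sum>j<n. Li_coeff v j) \<le> C * sqrt n"
    using Li_coeff_sum_bound[of N v] assms by auto
  have "norm (Li_coeff ((s, z) # v) n) \<le> C * sqrt n / real n ^ s" for n
  proof -
    have "norm (Li_coeff ((s, z) # v) n) = norm (\<Sum>j<n. Li_coeff v j) / real n ^ s"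
      using root_unity_norm[of N z] assms by (simp add: norm_mult norm_divide norm_power)
    also have "\<dots> \<le> C * sqrt n / real n ^ s" by (intro divide_right_mono C) auto
    finally show ?thesis .
  qed
  with C(1) that show thesis by blast
qed

lemma Li_coeff_bound_pos:
  assumes "N > 0" "root_word N w"
  obtains C where "C \<ge> 0" "\<And>n. n > 0 \<Longrightarrow> norm (Li_coeff w n) \<le> C * sqrt n / real n"
proof (cases w)
  case Nil
  then show ?thesis using that[of 0] by simp
next
  case (Cons a v)
  obtain s z where a: "a = (s, z)" by (cases a)
  obtain C where C: "C \<ge> 0" "\<And>n. norm (Li_coeff w n) \<le> C * sqrt n / real n ^ s"
    using Li_coeff_bound[of N s z v] assms Cons a by auto
  have s: "s > 0" using assms Cons a by auto
  have "norm (Li_coeff w n) \<le> C * sqrt n / real n" if "n > 0" for n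
  proof -
    have "C * sqrt n / real n ^ s \<le> C * sqrt n / real n ^ 1"
      using s that C by (intro divide_left_mono power_increasing) auto
    with C(2)[of n] show ?thesis by simp
  qed
  with C(1) that show ?thesis by blast
qed

lemma Li_coeff_tendsto_0:
  assumes "N > 0" "root_word N w"
  shows "Li_coeff w \<longlonglongrightarrow> 0"
proof -
  obtain C where C: "\<And>n. n > 0 \<Longrightarrow> norm (Li_coeff w n) \<le> C * sqrt n / real n"
    using Li_coeff_bound_pos[OF assms] by metis
  have "eventually (\<lambda>n. norm (Li_coeff w n) \<le> C * (1 / sqrt n)) sequentially"
    using eventually_gt_at_top[of 0]
  proof eventually_elim
    case (elim n)
    then have "sqrt n / real n = 1 / sqrt n" by (simp add: field_simps)
    with C[OF elim] show ?case by (metis times_divide_eq_right)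
  qed
  moreover have "(\<lambda>n. C * (1 / sqrt (real n))) \<longlonglongrightarrow> 0"
    by (intro tendsto_mult_right_zero tendsto_divide_0[OF tendsto_const]
        filterlim_at_top_imp_at_infinity filterlim_compose[OF sqrt_at_top filterlim_real_sequentially])
  ultimately show ?thesis by (rule Lim_null_comparison)
qed

lemma summable_n_sqrt: "summable (\<lambda>n. sqrt n / real n ^ 2)"
proof -
  have "summable (\<lambda>n. real n powr (- (3/2)))" by (subst summable_real_powr_iff) auto
  moreover have "sqrt n / real n ^ 2 = real n powr (- (3/2))" for n :: nat
  proof (cases "n = 0")
    case False
    then have "sqrt n / real n ^ 2 = real n powr (1/2) / real n powr 2"
      by (simp add: powr_half_sqrt)
    also have "\<dots> = real n powr (1/2 - 2)" by (subst powr_diff) simp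
    finally show ?thesis by simp
  qed auto
  ultimately show ?thesis by simp
qed

section \<open>Power series of multiple polylogarithms\<close>

definition polylog :: "(nat \<times> complex) list \<Rightarrow> complex \<Rightarrow> complex" where
  "polylog w u = (\<Sum>n. Li_coeff w n * u ^ n)"

lemma Li_coeff_summable_inside:
  assumes "N > 0" "root_word N w" "norm u < 1"
  shows "summable (\<lambda>n. Li_coeff w n * u ^ n)"
proof -
  have "Bseq (Li_coeff w)"
    using Li_coeff_tendsto_0[OF assms(1,2)] convergentI convergent_imp_Bseq by blast
  then obtain C where C: "\<And>n. norm (Li_coeff w n) \<le> C" by (auto simp: Bseq_def)
  show ?thesis
  proof (rule summable_comparison_test')
    show "summable (\<lambda>n. C * norm u ^ n)" using assms by (intro summable_mult summable_geometric) auto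
    show "norm (Li_coeff w n * u ^ n) \<le> C * norm u ^ n" for n
      unfolding norm_mult norm_power by (intro mult_right_mono C) auto
  qed
qed

lemma abs_summable_disc:
  fixes d :: "nat \<Rightarrow> complex"
  assumes "summable (\<lambda>n. norm (d n))"
  shows "continuous_on (cball 0 1) (\<lambda>u. \<Sum>n. d n * u ^ n)"
    and "\<And>u. norm u \<le> 1 \<Longrightarrow> summable (\<lambda>n. d n * u ^ n)"
proof -
  have le: "norm (d n * u ^ n) \<le> norm (d n)" if "norm u \<le> 1" for u n
    using that by (simp add: norm_mult norm_power mult_left_le power_le_one)
  show "summable (\<lambda>n. d n * u ^ n)" if "norm u \<le> 1" for u
    by (rule summable_comparison_test'[OF assms]) (use le that in auto)
  have "uniform_limit (cball 0 1) (\<lambda>n u. \<Sum>i<n. d i * u ^ i) (\<lambda>u. \<Sum>n. d n * u ^ n) sequentially"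
    by (rule Weierstrass_m_test[OF _ assms]) (use le in auto)
  then show "continuous_on (cball 0 1) (\<lambda>u. \<Sum>n. d n * u ^ n)"
    by (rule uniform_limit_theorem[rotated]) (auto intro!: always_eventually continuous_intros)
qed

text \<open>Multiplying by 1 - u replaces the coefficients by their differences, which are
  absolutely summable. So the series converges on the closed disc except at 1, in a form whose
  continuity is visible.\<close>

lemma Abel_summation:
  fixes b :: "nat \<Rightarrow> complex"
  assumes b: "b \<longlonglongrightarrow> 0" and d: "summable (\<lambda>n. norm (b (Suc n) - b n))"
    and b0: "b 0 = 0" and u: "norm u \<le> 1" "u \<noteq> 1"
  shows "(\<lambda>n. b n * u ^ n) sums (u * (\<Sum>n. (b (Suc n) - b n) * u ^ n) / (1 - u))"
proof -
  have 1: "(1 - u) * (\<Sum>n<K. b n * u ^ n) = u * (\<Sum>n<K. (b (Suc n) - b n) * u ^ n) - b K * u ^ K" for K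
  proof (induction K)
    case (Suc K)
    have "(1 - u) * (\<Sum>n<Suc K. b n * u ^ n) = (1 - u) * (\<Sum>n<K. b n * u ^ n) + (1 - u) * (b K * u ^ K)"
      by (simp only: sum.lessThan_Suc distrib_left)
    also have "\<dots> = u * ((\<Sum>n<K. (b (Suc n) - b n) * u ^ n) + (b (Suc K) - b K) * u ^ K) - b (Suc K) * u ^ Suc K"
      unfolding Suc by (simp only: power_Suc ring_distribs) (simp add: algebra_simps)
    finally show ?case by (simp only: sum.lessThan_Suc)
  qed (simp add: b0)
  have "(\<lambda>K. (u * (\<Sum>n<K. (b (Suc n) - b n) * u ^ n) - b K * u ^ K) / (1 - u))
     \<longlonglongrightarrow> (u * (\<Sum>n. (b (Suc n) - b n) * u ^ n) - 0) / (1 - u)"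
  proof (intro tendsto_intros)
    show "(\<lambda>K. \<Sum>n<K. (b (Suc n) - b n) * u ^ n) \<longlonglongrightarrow> (\<Sum>n. (b (Suc n) - b n) * u ^ n)"
      using abs_summable_disc(2)[OF d u(1)] by (rule summable_LIMSEQ)
    show "(\<lambda>K. b K * u ^ K) \<longlonglongrightarrow> 0"
    proof (rule Lim_null_comparison[OF _ tendsto_norm_zero[OF b]])
      show "\<forall>\<^sub>F K in sequentially. norm (b K * u ^ K) \<le> norm (b K)"
        using u(1) by (simp add: norm_mult norm_power mult_left_le power_le_one)
    qed
    show "1 - u \<noteq> 0" using u by simp
  qed
  then show ?thesis
    unfolding sums_def using u(2) by (simp flip: 1)
qed

text \<open>With head exponent at least 2 the coefficients are O(n^(-3/2)) and convergence is
  absolute. Head exponent 1 needs Abel summation in the variable z * u, whose only bad point is z *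
  u = 1. The limit is taken within the whole closed disc because the paths used later do not
  approach the boundary radially.\<close>

lemma polylog_boundary:
  assumes N: "N > 0" and root_word: "root_word N w" and p: "norm p = 1"
    and convergent_word: "w = [] \<or> fst (hd w) \<noteq> 1 \<or> snd (hd w) * p \<noteq> 1"
  shows "summable (\<lambda>n. Li_coeff w n * p ^ n)" "(polylog w \<longlongrightarrow> polylog w p) (at p within cball 0 1)"
proof -
  have abs_case: "summable (\<lambda>n. Li_coeff w n * p ^ n) \<and> (polylog w \<longlongrightarrow> polylog w p) (at p within cball 0 1)"
    if "summable (\<lambda>n. norm (Li_coeff w n))"
    using abs_summable_disc[OF that] p unfolding continuous_on_def polylog_def[abs_def] by simp
  have "summable (\<lambda>n. Li_coeff w n * p ^ n) \<and> (polylog w \<longlongrightarrow> polylog w p) (at p within cball 0 1)"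
  proof (cases w)
    case Nil
    show ?thesis
      by (rule abs_case, rule summable_finite[of "{0}"]) (auto simp: Nil)
  next
    case (Cons a v)
    obtain s z where a: "a = (s, z)" by (cases a)
    have okv: "root_word N v" and s: "s > 0" and z: "z ^ N = 1" using root_word Cons a by auto
    have nz: "norm z = 1" using N z by (rule root_unity_norm)
    show ?thesis
    proof (cases "s = 1")
      case False
      obtain C where C: "C \<ge> 0" "\<And>n. norm (Li_coeff w n) \<le> C * sqrt n / real n ^ s"
        using Li_coeff_bound[of N s z v] N root_word Cons a by auto
      have "norm (Li_coeff w n) \<le> C * (sqrt n / real n ^ 2)" for n
      proof (cases "n = 0")
        case False
        have "C * sqrt n / real n ^ s \<le> C * sqrt n / real n ^ 2"
          using s \<open>s \<noteq> 1\<close> False C by (intro divide_left_mono power_increasing) auto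
        with C(2)[of n] show ?thesis by simp
      qed (use Cons a in simp)
      then have "summable (\<lambda>n. norm (Li_coeff w n))"
        by (intro summable_comparison_test'[OF summable_mult[OF summable_n_sqrt, of C]]) auto
      then show ?thesis by (rule abs_case)
    next
      case True
      \<comment> \<open>The factor z ^ n is left to the variable: the differences of
        \<open>b\<close> are O(n^(-3/2)), whereas those of \<open>Li_coeff w\<close> need not be
        summable.\<close>
      define b where "b n = (\<Sum>j<n. Li_coeff v j) / of_nat n" for n
      obtain C where C: "C \<ge> 0" "\<And>n. norm (\<Sum>j<n. Li_coeff v j) \<le> C * sqrt n"
        using Li_coeff_sum_bound[OF N okv] by auto
      obtain C1 where C1: "C1 \<ge> 0" "\<And>n. n > 0 \<Longrightarrow> norm (Li_coeff v n) \<le> C1 * sqrt n / real n"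
        using Li_coeff_bound_pos[OF N okv] by metis
      have "norm (b (Suc n) - b n) \<le> (C1 + C) * (sqrt n / real n ^ 2)" if "n \<ge> 1" for n
      proof -
        have n: "complex_of_nat n \<noteq> 0" "1 + complex_of_nat n \<noteq> 0" using that of_nat_eq_0_iff[of "Suc n"] by auto
        then have "b (Suc n) - b n = Li_coeff v n / of_nat (Suc n) - (\<Sum>j<n. Li_coeff v j) / (of_nat n * of_nat (Suc n))"
          unfolding b_def by (simp add: divide_simps) (simp add: algebra_simps)
        also have "norm \<dots> \<le> norm (Li_coeff v n) / Suc n + norm (\<Sum>j<n. Li_coeff v j) / (real n * Suc n)"
          by (rule order_trans[OF norm_triangle_ineq4])
            (simp add: norm_divide norm_mult del: of_nat_Suc)
        also have "\<dots> \<le> (C1 * sqrt n / real n) / n + (C * sqrt n) / (real n * n)"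
          using that C C1 by (intro add_mono frac_le mult_left_mono) auto
        also have "\<dots> = (C1 + C) * (sqrt n / real n ^ 2)"
          by (simp add: power2_eq_square add_divide_distrib ring_distribs)
        finally show ?thesis .
      qed
      then have d: "summable (\<lambda>n. norm (b (Suc n) - b n))"
        by (intro summable_comparison_test'[OF summable_mult[OF summable_n_sqrt, of "C1 + C"], of 1]) auto
      have "Li_coeff ((1, 1) # v) \<longlonglongrightarrow> 0" using Li_coeff_tendsto_0[OF N, of "(1, 1) # v"] okv by simp
      moreover have "Li_coeff ((1, 1) # v) = b" by (simp add: fun_eq_iff b_def)
      ultimately have b: "b \<longlonglongrightarrow> 0" by simp
      define g where "g u = z * u * (\<Sum>n. (b (Suc n) - b n) * (z * u) ^ n) / (1 - z * u)" for u
      have w: "Li_coeff w n * u ^ n = b n * (z * u) ^ n" for n u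
        by (simp add: Cons a True b_def power_mult_distrib)
      have sm: "(\<lambda>n. Li_coeff w n * u ^ n) sums g u" if "norm u \<le> 1" "z * u \<noteq> 1" for u
        unfolding w g_def using Abel_summation[OF b d, of "z * u"] that nz
        by (simp add: b_def norm_mult)
      have zp: "z * p \<noteq> 1" using convergent_word Cons a True by simp
      have "((\<lambda>u. \<Sum>n. (b (Suc n) - b n) * (z * u) ^ n) \<longlongrightarrow> (\<Sum>n. (b (Suc n) - b n) * (z * p) ^ n)) (at p within cball 0 1)"
      proof -
        have "continuous_on (cball 0 1) (\<lambda>u. \<Sum>n. (b (Suc n) - b n) * (z * u) ^ n)"
          by (rule continuous_on_compose2[OF abs_summable_disc(1)[OF d]])
            (auto intro!: continuous_intros simp: norm_mult nz)
        then show ?thesis using p by (simp add: continuous_on_def)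
      qed
      then have "(g \<longlongrightarrow> g p) (at p within cball 0 1)"
        unfolding g_def[abs_def] using zp by (intro tendsto_intros) auto
      moreover have "eventually (\<lambda>u. g u = polylog w u) (at p within cball 0 1)"
      proof -
        have "((\<lambda>u. z * u) \<longlongrightarrow> z * p) (at p within cball 0 1)" by (intro tendsto_intros)
        from tendsto_imp_eventually_ne[OF this zp]
        have "eventually (\<lambda>u. z * u \<noteq> 1) (at p within cball 0 1)" .
        moreover have "eventually (\<lambda>u. norm u \<le> 1) (at p within cball 0 1)"
          by (simp add: eventually_at_filter)
        ultimately show ?thesis
          by eventually_elim (use sm in \<open>auto simp: polylog_def sums_iff\<close>)
      qed
      moreover have "g p = polylog w p" using sm[of p] zp p by (auto simp: polylog_def sums_iff)
      ultimately have "(polylog w \<longlongrightarrow> polylog w p) (at p within cball 0 1)"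
        by (simp add: filterlim_cong[OF refl refl])
      moreover have "summable (\<lambda>n. Li_coeff w n * p ^ n)" using sm[of p] zp p by (auto simp: sums_iff)
      ultimately show ?thesis by blast
    qed
  qed
  then show "summable (\<lambda>n. Li_coeff w n * p ^ n)" "(polylog w \<longlongrightarrow> polylog w p) (at p within cball 0 1)" by auto
qed

section \<open>The algebra of cyclotomic multiple zeta values\<close>

lemma convergent_word_sums:
  assumes "N > 0" "root_word N w" "convergent_word w"
  shows "Li_coeff w sums polylog w 1"
proof -
  have "w = [] \<or> fst (hd w) \<noteq> 1 \<or> snd (hd w) * 1 \<noteq> 1"
    using assms(3) by (cases w) (auto simp: convergent_word_def)
  then show ?thesis
    using polylog_boundary(1)[OF assms(1,2), of 1] by (simp add: polylog_def summable_sums)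
qed

lemma convergent_word_partial:
  assumes "N > 0" "root_word N w" "convergent_word w"
  shows "(\<lambda>M. \<Sum>n\<le>M. Li_coeff w n) \<longlonglongrightarrow> polylog w 1"
  using convergent_word_sums[OF assms] by (simp add: sums_def_le)

text \<open>\<open>Li\<close> is a \<open>lim\<close>, which says nothing about a divergent
  sequence. Admissible words converge, so every generator is a genuine boundary value of a power
  series.\<close>

lemma CMZV_gens_eq:
  assumes "N > 0"
  shows "CMZV_gens k N = {polylog w 1 | w. w \<noteq> [] \<and> root_word N w \<and> weight w = k \<and> convergent_word w}" (is "_ = ?R")
proof (intro equalityI subsetI)
  fix x assume "x \<in> CMZV_gens k N"
  then obtain s z where x: "x = Li s z" and l: "length s = length z" "s \<noteq> []" "\<forall>j \<in> set s. j > 0"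
    "sum_list s = k" "\<forall>w \<in> set z. w ^ N = 1" "\<not> (hd s = 1 \<and> hd z = 1)"
    unfolding CMZV_gens_def by blast
  let ?w = "zip s z"
  have w: "?w \<noteq> []" "root_word N ?w" "weight ?w = k" "convergent_word ?w"
    using l by (auto simp: root_word_def weight_def convergent_word_def dest: set_zip_leftD set_zip_rightD)
      (cases s; cases z; simp)+
  have "x = polylog ?w 1"
    unfolding x Li_def Li_partial_eq[OF l(1)] by (rule limI[OF convergent_word_partial[OF assms w(2,4)]])
  with w show "x \<in> ?R" by blast
next
  fix x assume "x \<in> ?R"
  then obtain w where x: "x = polylog w 1" and w: "w \<noteq> []" "root_word N w" "weight w = k" "convergent_word w" by blast
  let ?s = "map fst w" and ?z = "map snd w"
  have z: "zip ?s ?z = w" by (rule zip_map_fst_snd)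
  have "x = Li ?s ?z"
  proof -
    have "Li_partial ?s ?z = (\<lambda>M. \<Sum>n\<le>M. Li_coeff w n)"
      using z by (simp add: fun_eq_iff Li_partial_eq)
    then show ?thesis
      unfolding x Li_def using limI[OF convergent_word_partial[OF assms w(2,4)]] by simp
  qed
  moreover have "\<not> (hd ?s = 1 \<and> hd ?z = 1)"
    using w by (cases w) (auto simp: convergent_word_def)
  moreover have "length ?s = length ?z" "?s \<noteq> []" "\<forall>j \<in> set ?s. j > 0"
    "sum_list ?s = k" "\<forall>w \<in> set ?z. w ^ N = 1"
    using w by (auto simp: root_word_def weight_def)
  ultimately show "x \<in> CMZV_gens k N" unfolding CMZV_gens_def by blast
qed

section \<open>Rational spans of the values\<close>

lemma CMZV_0: "x \<in> CMZV 0 N \<longleftrightarrow> x \<in> \<rat>"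
  by (auto simp: CMZV_def Rats_def)

lemma CMZV_pos: "0 < k \<Longrightarrow> x \<in> CMZV k N \<longleftrightarrow>
    (\<exists>(n::nat) c v. (\<forall>i<n. v i \<in> CMZV_gens k N) \<and> x = (\<Sum>i<n. of_rat (c i) * v i))"
  by (simp add: CMZV_def)

lemma CMZV_gen: "x \<in> CMZV_gens k N \<Longrightarrow> 0 < k \<Longrightarrow> x \<in> CMZV k N"
  unfolding CMZV_def by (auto intro!: exI[of _ 1] exI[of _ "\<lambda>_. 1"] exI[of _ "\<lambda>_. x"])

lemma CMZV_zero: "0 \<in> CMZV k N"
  by (cases "k = 0") (auto simp: CMZV_0, auto simp: CMZV_def intro!: exI[of _ 0])

lemma CMZV_add:
  assumes "x \<in> CMZV k N" "y \<in> CMZV k N"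
  shows "x + y \<in> CMZV k N"
proof (cases "k = 0")
  case True
  then show ?thesis using assms by (simp add: CMZV_0)
next
  case False
  from assms False obtain n :: nat and c v where x: "\<forall>i<n. v i \<in> CMZV_gens k N" "x = (\<Sum>i<n. of_rat (c i) * v i)"
    by (auto simp only: CMZV_pos neq0_conv)
  from assms False obtain m :: nat and d u where y: "\<forall>i<m. u i \<in> CMZV_gens k N" "y = (\<Sum>i<m. of_rat (d i) * u i)"
    by (auto simp only: CMZV_pos neq0_conv)
  let ?c = "\<lambda>i. if i < n then c i else d (i - n)" and ?v = "\<lambda>i. if i < n then v i else u (i - n)"
  have "(\<Sum>i<n + m. of_rat (?c i) * ?v i) = x + y"
    unfolding x(2) y(2) by (simp add: sum.lessThan_Suc_shift lessThan_atLeast0 sum.atLeastLessThan_concat[symmetric, of 0 n "n + m"]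
        sum.shift_bounds_nat_ivl[of _ 0 n m, simplified add_0 add.commute[of m]])
  moreover have "\<forall>i<n + m. ?v i \<in> CMZV_gens k N" using x y by auto
  ultimately show ?thesis
    using False unfolding CMZV_def by (auto intro!: exI[of _ "n + m"] exI[of _ ?c] exI[of _ ?v])
qed

lemma CMZV_scale:
  assumes "x \<in> CMZV k N"
  shows "of_rat q * x \<in> CMZV k N"
proof (cases "k = 0")
  case True
  then show ?thesis using assms by (simp add: CMZV_0)
next
  case False
  with assms obtain n :: nat and c v where x: "\<forall>i<n. v i \<in> CMZV_gens k N" "x = (\<Sum>i<n. of_rat (c i) * v i)"
    by (auto simp only: CMZV_pos neq0_conv)
  have "of_rat q * x = (\<Sum>i<n. of_rat (q * c i) * v i)"
    by (simp add: x sum_distrib_left of_rat_mult mult.assoc)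
  with x False show ?thesis
    unfolding CMZV_def by (auto intro!: exI[of _ n] exI[of _ "\<lambda>i. q * c i"] exI[of _ v])
qed

lemma CMZV_Rats_mult: "q \<in> \<rat> \<Longrightarrow> x \<in> CMZV k N \<Longrightarrow> q * x \<in> CMZV k N"
  by (auto simp: Rats_def CMZV_scale)

lemma CMZV_minus: "x \<in> CMZV k N \<Longrightarrow> - x \<in> CMZV k N"
  using CMZV_scale[of x k N "-1"] by simp

lemma CMZV_diff: "x \<in> CMZV k N \<Longrightarrow> y \<in> CMZV k N \<Longrightarrow> x - y \<in> CMZV k N"
  using CMZV_add[of x k N "- y"] CMZV_minus[of y] by simp

lemma CMZV_sum_list: "(\<And>x. x \<in> set xs \<Longrightarrow> f x \<in> CMZV k N) \<Longrightarrow> (\<Sum>x\<leftarrow>xs. f x) \<in> CMZV k N"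
  by (induction xs) (auto intro: CMZV_zero CMZV_add)

lemma CMZV_polylog:
  assumes "N > 0" "root_word N w" "convergent_word w"
  shows "polylog w 1 \<in> CMZV (weight w) N"
proof (cases w)
  case Nil
  have "Li_coeff [] sums 1" using sums_finite[of "{0}" "Li_coeff []"] by simp
  then have "polylog w 1 = 1" using convergent_word_sums[OF assms] Nil sums_unique2 by blast
  then show ?thesis by (simp add: Nil CMZV_0)
next
  case (Cons a v)
  then have "0 < weight w" using assms by (cases a) simp
  then show ?thesis using assms Cons by (intro CMZV_gen) (auto simp: CMZV_gens_eq)
qed

lemma CMZV_induct [consumes 2, case_names zero add]:
  assumes "x \<in> CMZV k N" "k > 0" "P 0"
    and "\<And>x q v. P x \<Longrightarrow> v \<in> CMZV_gens k N \<Longrightarrow> P (x + of_rat q * v)"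
  shows "P x"
proof -
  obtain n :: nat and c v where x: "\<forall>i<n. v i \<in> CMZV_gens k N" "x = (\<Sum>i<n. of_rat (c i) * v i)"
    using assms(1,2) by (auto simp only: CMZV_pos)
  have "m \<le> n \<Longrightarrow> P (\<Sum>i<m. of_rat (c i) * v i)" for m
    by (induction m) (use assms(3,4) x in auto)
  then show ?thesis using x by blast
qed

text \<open>The quasi-shuffle of two words; the third kind of term collects the pairs whose leading
  indices coincide.\<close>

fun stuffle :: "(nat \<times> complex) list \<Rightarrow> (nat \<times> complex) list \<Rightarrow> (nat \<times> complex) list list" where
  "stuffle [] v = [v]"
| "stuffle u [] = [u]"
| "stuffle (a # u) (b # v) = map ((#) a) (stuffle u (b # v)) @ map ((#) b) (stuffle (a # u) v)
     @ map ((#) (fst a + fst b, snd a * snd b)) (stuffle u v)"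

text \<open>Index pairs are sorted into the two open triangles and the diagonal, one for each kind
  of term in \<open>stuffle\<close>.\<close>

lemma sum_product_split:
  fixes f g :: "nat \<Rightarrow> 'a :: comm_semiring_0"
  shows "(\<Sum>n<M. f n) * (\<Sum>n<M. g n) =
    (\<Sum>n<M. f n * (\<Sum>j<n. g j)) + (\<Sum>n<M. g n * (\<Sum>j<n. f j)) + (\<Sum>n<M. f n * g n)"
  by (induction M) (simp_all add: algebra_simps)

lemma sum_list_sum_commute: "(\<Sum>w\<leftarrow>ws. \<Sum>n\<in>A. f w n) = (\<Sum>n\<in>A. \<Sum>w\<leftarrow>ws. f w n)"
  by (induction ws) (auto simp: sum.distrib)

lemma Li_coeff_map_Cons:
  "(\<Sum>w\<leftarrow>map ((#) (s, z)) ws. \<Sum>n<M. Li_coeff w n)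
     = (\<Sum>n<M. z ^ n / of_nat n ^ s * (\<Sum>w\<leftarrow>ws. \<Sum>j<n. Li_coeff w j))"
proof -
  have "(\<Sum>w\<leftarrow>map ((#) (s, z)) ws. \<Sum>n<M. Li_coeff w n)
     = (\<Sum>n<M. \<Sum>w\<leftarrow>ws. z ^ n / of_nat n ^ s * (\<Sum>j<n. Li_coeff w j))"
    by (simp only: map_map o_def sum_list_sum_commute Li_coeff.simps)
  then show ?thesis by (simp only: sum_list_const_mult sum_list_sum_commute)
qed

text \<open>The identity is exact for sums truncated at a common bound, so convergence enters only
  when the limit is taken.\<close>

lemma stuffle_sum:
  "(\<Sum>n<M. Li_coeff u n) * (\<Sum>n<M. Li_coeff v n) = (\<Sum>w\<leftarrow>stuffle u v. \<Sum>n<M. Li_coeff w n)"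
proof (induction u v arbitrary: M rule: stuffle.induct)
  case (1 v)
  then show ?case by (simp add: sum_Li_coeff_Nil)
next
  case (2 a u)
  then show ?case by (simp add: sum_Li_coeff_Nil)
next
  case (3 a u b v)
  obtain s z t y where ab: "a = (s, z)" "b = (t, y)" by (cases a, cases b) auto
  let ?f = "\<lambda>n. z ^ n / of_nat n ^ s" and ?g = "\<lambda>n. y ^ n / of_nat n ^ t"
  let ?U = "\<lambda>n. \<Sum>j<n. Li_coeff u j" and ?V = "\<lambda>n. \<Sum>j<n. Li_coeff v j"
  have "(\<Sum>n<M. Li_coeff (a # u) n) * (\<Sum>n<M. Li_coeff (b # v) n) =
     (\<Sum>n<M. ?f n * (?U n * (\<Sum>j<n. Li_coeff (b # v) j)))
   + (\<Sum>n<M. ?g n * ((\<Sum>j<n. Li_coeff (a # u) j) * ?V n))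
   + (\<Sum>n<M. ((z * y) ^ n / of_nat n ^ (s + t)) * (?U n * ?V n))"
    by (subst sum_product_split)
      (simp add: ab mult_ac power_mult_distrib power_add)
  also have "\<dots> = (\<Sum>w\<leftarrow>stuffle (a # u) (b # v). \<Sum>n<M. Li_coeff w n)"
    unfolding 3 by (simp add: ab Li_coeff_map_Cons del: Li_coeff.simps map_map)
  finally show ?case .
qed

lemma stuffle_root_word:
  "root_word N u \<Longrightarrow> root_word N v \<Longrightarrow> w \<in> set (stuffle u v) \<Longrightarrow> root_word N w \<and> weight w = weight u + weight v"
proof (induction u v arbitrary: w rule: stuffle.induct)
  case (3 a u b v)
  obtain s z t y where ab: "a = (s, z)" "b = (t, y)" by (cases a, cases b) auto
  from 3(6) consider w' where "w = a # w'" "w' \<in> set (stuffle u (b # v))"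
    | w' where "w = b # w'" "w' \<in> set (stuffle (a # u) v)"
    | w' where "w = (s + t, z * y) # w'" "w' \<in> set (stuffle u v)"
    by (auto simp: ab)
  then show ?case
  proof cases
    case 1
    with 3(1)[of w'] 3(4,5) show ?thesis by (simp add: ab)
  next
    case 2
    with 3(2)[of w'] 3(4,5) show ?thesis by (simp add: ab)
  next
    case 3
    with "3.IH"(3)[of w'] "3.prems"(1,2) show ?thesis by (simp add: ab power_mult_distrib)
  qed
qed auto

text \<open>A merged head has exponent at least 2, and any other head is the head of a factor, so
  (1, 1) cannot arise.\<close>

lemma stuffle_convergent_word:
  assumes "root_word N u" "root_word N v" "convergent_word u" "convergent_word v" "w \<in> set (stuffle u v)"
  shows "convergent_word w"
proof (cases "(u, v)" rule: stuffle.cases)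
  case (3 a u' b v')
  have "hd w \<in> {a, b, (fst a + fst b, snd a * snd b)}" using assms(5) 3 by auto
  moreover have "fst a > 0" "fst b > 0" "a \<noteq> (1, 1)" "b \<noteq> (1, 1)"
    using assms 3 by (auto simp: root_word_def convergent_word_def)
  ultimately show ?thesis by (auto simp: convergent_word_def)
qed (use assms in auto)

lemma polylog_mult:
  assumes N: "N > 0" and u: "root_word N u" "convergent_word u" and v: "root_word N v" "convergent_word v"
  shows "polylog u 1 * polylog v 1 \<in> CMZV (weight u + weight v) N"
proof -
  have "(\<lambda>M. (\<Sum>n<M. Li_coeff u n) * (\<Sum>n<M. Li_coeff v n)) \<longlonglongrightarrow> polylog u 1 * polylog v 1"
    using convergent_word_sums[OF N u] convergent_word_sums[OF N v] unfolding sums_def by (rule tendsto_mult)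
  moreover have "(\<lambda>M. \<Sum>w\<leftarrow>stuffle u v. \<Sum>n<M. Li_coeff w n) \<longlonglongrightarrow> (\<Sum>w\<leftarrow>stuffle u v. polylog w 1)"
  proof -
    have "(\<lambda>M. \<Sum>w\<leftarrow>ws. \<Sum>n<M. Li_coeff w n) \<longlonglongrightarrow> (\<Sum>w\<leftarrow>ws. polylog w 1)"
      if "set ws \<subseteq> set (stuffle u v)" for ws
      using that
    proof (induction ws)
      case (Cons w ws)
      then have "Li_coeff w sums polylog w 1"
        using convergent_word_sums[OF N] stuffle_root_word[OF u(1) v(1)] stuffle_convergent_word[OF u(1) v(1) u(2) v(2)] by auto
      with Cons show ?case by (simp add: sums_def tendsto_add)
    qed simp
    then show ?thesis by blast
  qed
  ultimately have "polylog u 1 * polylog v 1 = (\<Sum>w\<leftarrow>stuffle u v. polylog w 1)"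
    unfolding stuffle_sum by (rule LIMSEQ_unique)
  also have "\<dots> \<in> CMZV (weight u + weight v) N"
    using CMZV_polylog[OF N] stuffle_root_word[OF u(1) v(1)] stuffle_convergent_word[OF u(1) v(1) u(2) v(2)]
    by (intro CMZV_sum_list) metis
  finally show ?thesis .
qed

lemma CMZV_mult:
  assumes N: "N > 0" and "x \<in> CMZV j N" "y \<in> CMZV k N"
  shows "x * y \<in> CMZV (j + k) N"
proof (cases "j = 0 \<or> k = 0")
  case True
  then show ?thesis
    using assms CMZV_Rats_mult[of x y k N] CMZV_Rats_mult[of y x j N] by (auto simp: CMZV_0 mult.commute)
next
  case False
  then have jk: "j > 0" "k > 0" by auto
  have gen: "u * y \<in> CMZV (j + k) N" if u: "u \<in> CMZV_gens j N" for u
    using assms(3) jk(2)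
  proof (induction rule: CMZV_induct)
    case (add y q v)
    have "u * v \<in> CMZV (j + k) N"
      using polylog_mult[OF N] u add by (auto simp: CMZV_gens_eq[OF N])
    then have "u * y + of_rat q * (u * v) \<in> CMZV (j + k) N"
      using add by (intro CMZV_add CMZV_scale)
    then show ?case by (simp add: algebra_simps)
  qed (simp add: CMZV_zero)
  show ?thesis
    using assms(2) jk(1)
  proof (induction rule: CMZV_induct)
    case (add x q v)
    have "x * y + of_rat q * (v * y) \<in> CMZV (j + k) N"
      using gen[of v] add by (intro CMZV_add CMZV_scale)
    then show ?case by (simp add: algebra_simps)
  qed (simp add: CMZV_zero)
qed

lemma CMZV_power: "N > 0 \<Longrightarrow> x \<in> CMZV 1 N \<Longrightarrow> x ^ i \<in> CMZV i N"
  by (induction i) (auto simp: CMZV_0 dest: CMZV_mult[of N x 1])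

section \<open>Primitives of polylogarithms\<close>

text \<open>Evaluation at p multiplies the n-th coefficient by p ^ n, which alters only the head
  letter. Values at roots of unity are thereby values at 1 of words over the same roots.\<close>

fun scale_hd :: "complex \<Rightarrow> (nat \<times> complex) list \<Rightarrow> (nat \<times> complex) list" where
  "scale_hd a [] = []"
| "scale_hd a ((s, z) # v) = (s, a * z) # v"

lemma Li_coeff_mulhd: "Li_coeff (scale_hd a w) n = Li_coeff w n * a ^ n"
  by (cases "(a, w)" rule: scale_hd.cases) (auto simp: power_mult_distrib)

lemma polylog_mulhd: "polylog (scale_hd p w) 1 = polylog w p"
  by (simp add: polylog_def Li_coeff_mulhd)

lemma weight_mulhd [simp]: "weight (scale_hd a w) = weight w"
  by (cases "(a, w)" rule: scale_hd.cases) auto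

lemma root_word_mulhd: "root_word N w \<Longrightarrow> a ^ N = 1 \<Longrightarrow> root_word N (scale_hd a w)"
  by (cases "(a, w)" rule: scale_hd.cases) (auto simp: power_mult_distrib)

lemma polylog_Nil [simp]: "polylog [] u = 1"
proof -
  have "(\<lambda>n. Li_coeff [] n * u ^ n) sums 1" using sums_finite[of "{0}" "\<lambda>n. Li_coeff [] n * u ^ n"] by simp
  then show ?thesis by (simp add: polylog_def sums_iff)
qed

lemma polylog_deriv_diffs:
  assumes "N > 0" "root_word N w" "norm u < 1"
  shows "(polylog w has_field_derivative (\<Sum>n. diffs (Li_coeff w) n * u ^ n)) (at u)"
    and "summable (\<lambda>n. diffs (Li_coeff w) n * u ^ n)"
proof -
  have s: "summable (\<lambda>n. Li_coeff w n * x ^ n)" if "norm x < 1" for x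
    using Li_coeff_summable_inside assms that by blast
  show "summable (\<lambda>n. diffs (Li_coeff w) n * u ^ n)"
    using termdiff_converges[of u 1, OF assms(3) s] by auto
  show "(polylog w has_field_derivative (\<Sum>n. diffs (Li_coeff w) n * u ^ n)) (at u)"
    unfolding polylog_def[abs_def] using assms by (intro termdiffs_strong'[of 1] s) auto
qed

text \<open>Integration against du / u divides the n-th coefficient by n, which raises the head
  exponent. The word is nonempty, so the constant term vanishes and there is no logarithm.\<close>

lemma polylog_deriv_zero:
  assumes N: "N > 0" and root_word: "root_word N ((s, z) # v)" and u: "norm u < 1" "u \<noteq> 0"
  shows "(polylog ((Suc s, z) # v) has_field_derivative polylog ((s, z) # v) u / u) (at u)"
proof -
  have *: "diffs (Li_coeff ((Suc s, z) # v)) n = Li_coeff ((s, z) # v) (Suc n)" for n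
    by (simp add: diffs_def del: of_nat_Suc)
  have ok': "root_word N ((Suc s, z) # v)" using root_word by simp
  have "summable (\<lambda>n. Li_coeff ((s, z) # v) n * u ^ n)" using Li_coeff_summable_inside[OF N root_word u(1)] .
  then have "(\<lambda>n. Li_coeff ((s, z) # v) n * u ^ n) sums polylog ((s, z) # v) u"
    unfolding polylog_def by (rule summable_sums)
  then have "(\<lambda>n. Li_coeff ((s, z) # v) (Suc n) * u ^ Suc n) sums polylog ((s, z) # v) u"
    by (subst sums_Suc_iff) simp
  then have "(\<lambda>n. Li_coeff ((s, z) # v) (Suc n) * u ^ Suc n / u) sums (polylog ((s, z) # v) u / u)"
    by (rule sums_divide)
  then have "(\<lambda>n. diffs (Li_coeff ((Suc s, z) # v)) n * u ^ n) sums (polylog ((s, z) # v) u / u)"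
    using u(2) by (simp add: * del: Li_coeff.simps)
  then show ?thesis using polylog_deriv_diffs(1)[OF N ok' u(1)] by (simp add: sums_iff)
qed

text \<open>Expanding 1 / (a - u) as a geometric series turns the n-th coefficient into a power of 1
  / a times a partial sum of coefficients weighted by powers of a. The twist
  \<open>scale_hd a\<close> supplies the weights and the new head 1 / a the outer power.\<close>

lemma polylog_deriv_root:
  assumes N: "N > 0" and root_word: "root_word N w" and a: "a ^ N = 1" and u: "norm u < 1"
  shows "(polylog ((1, 1 / a) # scale_hd a w) has_field_derivative polylog w u / (a - u)) (at u)"
proof -
  let ?w = "(1, 1 / a) # scale_hd a w"
  have na: "norm a = 1" using N a by (rule root_unity_norm)
  then have a0: "a \<noteq> 0" and au: "a \<noteq> u" using u by auto
  have ok': "root_word N ?w" using root_word a root_word_mulhd[OF root_word a] by (simp add: power_divide)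
  define e where "e n = (1 / a) ^ n * (\<Sum>j<n. Li_coeff w j * a ^ j)" for n
  have *: "diffs (Li_coeff ?w) n = e (Suc n)" for n
    by (simp add: diffs_def e_def Li_coeff_mulhd del: of_nat_Suc)
  define S where "S = (\<Sum>n. e (Suc n) * u ^ n)"
  have S: "(\<lambda>n. e (Suc n) * u ^ n) sums S"
    unfolding S_def using polylog_deriv_diffs(2)[OF N ok' u] by (simp only: * summable_sums)
  have "(\<lambda>n. u * (e (Suc n) * u ^ n)) sums (u * S)" using S by (rule sums_mult)
  then have "(\<lambda>n. e (Suc n) * u ^ Suc n) sums (u * S)" by (simp add: mult_ac)
  then have "(\<lambda>n. e n * u ^ n) sums (u * S)" by (subst (asm) sums_Suc_iff) (simp add: e_def)
  moreover have "(\<lambda>n. a * (e (Suc n) * u ^ n)) sums (a * S)" using S by (rule sums_mult)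
  ultimately have "(\<lambda>n. a * (e (Suc n) * u ^ n) - e n * u ^ n) sums (a * S - u * S)"
    by (rule sums_diff[rotated])
  moreover have "a * (e (Suc n) * u ^ n) - e n * u ^ n = Li_coeff w n * u ^ n" for n
    using a0 by (simp add: e_def field_simps)
  ultimately have "polylog w u = (a - u) * S" by (simp add: polylog_def sums_iff algebra_simps)
  then have "S = polylog w u / (a - u)" using au by simp
  then show ?thesis using polylog_deriv_diffs(1)[OF N ok' u] unfolding * S_def by simp
qed

text \<open>The flag \<open>b\<close> says whether powers of \<open>Ln\<close> may occur, and \<open>Q\<close> is a set of boundary points at
  which all polylogarithms involved have to converge.\<close>

inductive_set polylog_span :: "nat \<Rightarrow> bool \<Rightarrow> complex set \<Rightarrow> nat \<Rightarrow> (complex \<Rightarrow> complex) set"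
  for N :: nat and b :: bool and Q :: "complex set" and k :: nat where
  base: "c \<in> CMZV j N \<Longrightarrow> b \<or> i = 0 \<Longrightarrow> root_word N w \<Longrightarrow> (\<And>p. p \<in> Q \<Longrightarrow> convergent_word (scale_hd p w))
    \<Longrightarrow> k = j + i + weight w \<Longrightarrow> (\<lambda>u. c * Ln u ^ i * polylog w u) \<in> polylog_span N b Q k"
| add: "f \<in> polylog_span N b Q k \<Longrightarrow> g \<in> polylog_span N b Q k \<Longrightarrow> (\<lambda>u. f u + g u) \<in> polylog_span N b Q k"

definition slit_disc :: "bool \<Rightarrow> complex set" where
  "slit_disc b = {u. norm u < 1 \<and> (b \<longrightarrow> u \<notin> \<real>\<^sub>\<le>\<^sub>0)}"

lemma polylog_span_const: "c \<in> CMZV k N \<Longrightarrow> (\<lambda>u. c) \<in> polylog_span N b Q k"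
  using polylog_span.base[of c k N b 0 "[]" Q k] by (simp add: convergent_word_def)

lemma polylog_span_scale:
  assumes "f \<in> polylog_span N b Q k" "q \<in> \<rat>"
  shows "(\<lambda>u. q * f u) \<in> polylog_span N b Q k"
  using assms(1)
proof induction
  case (base c j i w)
  then show ?case
    using polylog_span.base[of "q * c" j N b i w Q k] CMZV_Rats_mult[OF assms(2)] by (simp add: mult.assoc)
next
  case (add f g)
  then show ?case using polylog_span.add[of "\<lambda>u. q * f u" N b Q k "\<lambda>u. q * g u"] by (simp add: distrib_left)
qed

text \<open>Integration by parts raises the head exponent and lowers the power of \<open>Ln\<close>,
  so the induction runs over i. All heads produced have exponent at least 2, hence converge at every
  boundary point, and Q is arbitrary.\<close>

lemma polylog_span_primitive_log:
  assumes N: "N > 0" and b and c: "c \<in> CMZV j N" and root_word: "root_word N ((s, z) # v)"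
  shows "\<exists>g \<in> polylog_span N b Q (Suc (j + i + weight ((s, z) # v))). \<forall>u \<in> slit_disc b.
    (g has_field_derivative c * Ln u ^ i * polylog ((s, z) # v) u / u) (at u)"
  using c root_word
proof (induction i arbitrary: c s)
  case 0
  show ?case
  proof (intro bexI ballI)
    show "(\<lambda>u. c * Ln u ^ 0 * polylog ((Suc s, z) # v) u) \<in> polylog_span N b Q (Suc (j + 0 + weight ((s, z) # v)))"
      using 0 by (intro polylog_span.base[of c j]) (auto simp: convergent_word_def)
    fix u assume "u \<in> slit_disc b"
    then have "norm u < 1" "u \<noteq> 0" using \<open>b\<close> by (auto simp: slit_disc_def)
    then have "((\<lambda>u. c * polylog ((Suc s, z) # v) u) has_field_derivative c * (polylog ((s, z) # v) u / u)) (at u)"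
      by (intro DERIV_cmult polylog_deriv_zero[OF N 0(2)])
    then show "((\<lambda>u. c * Ln u ^ 0 * polylog ((Suc s, z) # v) u) has_field_derivative
      c * Ln u ^ 0 * polylog ((s, z) # v) u / u) (at u)" by simp
  qed
next
  case (Suc i)
  have "of_nat (Suc i) * c \<in> CMZV j N" using Suc.prems(1) by (intro CMZV_Rats_mult) auto
  from Suc.IH[OF this, of "Suc s"] Suc.prems(2) obtain g where
    g: "g \<in> polylog_span N b Q (Suc (j + i + weight ((Suc s, z) # v)))"
      "\<And>u. u \<in> slit_disc b \<Longrightarrow>
        (g has_field_derivative of_nat (Suc i) * c * Ln u ^ i * polylog ((Suc s, z) # v) u / u) (at u)"
    by auto
  have "(\<lambda>u. - 1 * g u) \<in> polylog_span N b Q (Suc (j + i + weight ((Suc s, z) # v)))"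
    using g(1) by (intro polylog_span_scale) auto
  then have "(\<lambda>u. c * Ln u ^ Suc i * polylog ((Suc s, z) # v) u + - 1 * g u)
      \<in> polylog_span N b Q (Suc (j + Suc i + weight ((s, z) # v)))"
    using Suc.prems \<open>b\<close> by (intro polylog_span.add polylog_span.base[of c j]) (auto simp: convergent_word_def)
  moreover have "((\<lambda>u. c * Ln u ^ Suc i * polylog ((Suc s, z) # v) u + - 1 * g u) has_field_derivative
      c * Ln u ^ Suc i * polylog ((s, z) # v) u / u) (at u)" if u: "u \<in> slit_disc b" for u
  proof -
    have u': "norm u < 1" "u \<noteq> 0" "u \<notin> \<real>\<^sub>\<le>\<^sub>0" using u \<open>b\<close> by (auto simp: slit_disc_def)
    show ?thesis
      by (rule derivative_eq_intros g(2)[OF u] polylog_deriv_zero[OF N Suc.prems(2) u'(1,2)] refl u'(3))+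
        (use u'(2) in \<open>simp add: field_simps\<close>)
  qed
  ultimately show ?case by blast
qed

text \<open>Q' is independent of Q: convergence of the primitive depends only on its own heads, and
  a head (1, 1 / a) fails only at the point a. For a root a, integration by parts against the power
  of \<open>Ln\<close> leaves an integral against du / u, to which the preceding lemma
  applies.\<close>

lemma polylog_span_primitive:
  assumes N: "N > 0" and f: "f \<in> polylog_span N b Q k"
    and a: "a = 0 \<and> b \<or> a ^ N = 1 \<and> a \<notin> Q'"
  shows "\<exists>g \<in> polylog_span N b Q' (Suc k). \<forall>u \<in> slit_disc b.
    (g has_field_derivative f u / (u - a)) (at u)"
  using f
proof induction
  case (add f f')
  then obtain g g' where g: "g \<in> polylog_span N b Q' (Suc k)" "g' \<in> polylog_span N b Q' (Suc k)"
    "\<And>u. u \<in> slit_disc b \<Longrightarrow> (g has_field_derivative f u / (u - a)) (at u)"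
    "\<And>u. u \<in> slit_disc b \<Longrightarrow> (g' has_field_derivative f' u / (u - a)) (at u)" by blast
  show ?case
    using g by (intro bexI[of _ "\<lambda>u. g u + g' u"] ballI polylog_span.add)
      (auto simp: add_divide_distrib intro: DERIV_add)
next
  case (base c j i w)
  show ?case
  proof (cases "a = 0 \<and> b")
    case True
    show ?thesis
    proof (cases w)
      case Nil
      show ?thesis
      proof (intro bexI ballI)
        show "(\<lambda>u. c / of_nat (Suc i) * Ln u ^ Suc i * polylog [] u) \<in> polylog_span N b Q' (Suc k)"
          using base Nil True CMZV_Rats_mult[of "1 / of_nat (Suc i)" c j N]
          by (intro polylog_span.base[of _ j]) (auto simp: convergent_word_def)
        fix u assume "u \<in> slit_disc b"
        then have u: "u \<noteq> 0" "u \<notin> \<real>\<^sub>\<le>\<^sub>0" using True by (auto simp: slit_disc_def)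
        have [simp]: "1 + complex_of_nat i \<noteq> 0" using of_nat_eq_0_iff[of "Suc i"] by auto
        show "((\<lambda>u. c / of_nat (Suc i) * Ln u ^ Suc i * polylog [] u) has_field_derivative
            c * Ln u ^ i * polylog w u / (u - a)) (at u)"
          unfolding polylog_Nil Nil
          by (rule derivative_eq_intros refl u(2))+
            (use u True in \<open>simp add: divide_simps\<close>)
      qed
    next
      case (Cons d v)
      then show ?thesis
        using polylog_span_primitive_log[OF N _ base(1), of b "fst d" "snd d" v Q' i] base True by simp
    qed
  next
    case False
    with a have a: "a ^ N = 1" "a \<notin> Q'" by auto
    let ?w = "(1, 1 / a) # scale_hd a w"
    have a0: "a \<noteq> 0" using a N by (auto simp: power_0_left)
    have okw: "root_word N ?w" using root_word_mulhd[OF base(3) a(1)] a by (simp add: power_divide)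
    \<comment> \<open>The remainder of the integration by parts. For i = 0 the truncated exponent i
      - 1 is harmless because the factor i vanishes.\<close>
    have "\<exists>g \<in> polylog_span N b Q' (Suc k). \<forall>u \<in> slit_disc b.
      (g has_field_derivative of_nat i * c * Ln u ^ (i - 1) * polylog ?w u / u) (at u)"
    proof (cases i)
      case 0
      then show ?thesis using polylog_span_const[OF CMZV_zero] by (intro bexI[of _ "\<lambda>u. 0"]) auto
    next
      case (Suc i')
      have "of_nat i * c \<in> CMZV j N" using base(1) by (intro CMZV_Rats_mult) auto
      from polylog_span_primitive_log[OF N _ this okw, of b Q' i'] Suc base(2,5) show ?thesis by simp
    qed
    then obtain g where g: "g \<in> polylog_span N b Q' (Suc k)"
      "\<And>u. u \<in> slit_disc b \<Longrightarrow>
        (g has_field_derivative of_nat i * c * Ln u ^ (i - 1) * polylog ?w u / u) (at u)" by blast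
    show ?thesis
    proof (intro bexI ballI)
      have "(\<lambda>u. c * Ln u ^ i * polylog ?w u) \<in> polylog_span N b Q' (Suc k)"
        using base okw a a0 by (intro polylog_span.base[of c j]) (auto simp: convergent_word_def)
      then show "(\<lambda>u. - 1 * (c * Ln u ^ i * polylog ?w u) + g u) \<in> polylog_span N b Q' (Suc k)"
        using g(1) by (intro polylog_span.add polylog_span_scale) auto
      fix u assume u: "u \<in> slit_disc b"
      then have nu: "norm u < 1" by (simp add: slit_disc_def)
      then have au: "a \<noteq> u" using root_unity_norm[OF N a(1)] by auto
      have "((\<lambda>u. c * Ln u ^ i * polylog ?w u) has_field_derivative
         of_nat i * c * Ln u ^ (i - 1) * polylog ?w u / u + c * Ln u ^ i * (polylog w u / (a - u))) (at u)"
      proof (cases "i = 0")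
        case True
        then show ?thesis
          using DERIV_cmult[OF polylog_deriv_root[OF N base(3) a(1) nu], of c] by simp
      next
        case False
        then have "u \<notin> \<real>\<^sub>\<le>\<^sub>0" using u base(2) by (auto simp: slit_disc_def)
        then have "((\<lambda>u. Ln u ^ i) has_field_derivative of_nat i * Ln u ^ (i - 1) / u) (at u)"
          by (auto intro!: derivative_eq_intros simp: divide_inverse mult_ac)
        from DERIV_mult[OF DERIV_cmult[OF this, of c] polylog_deriv_root[OF N base(3) a(1) nu]]
        show ?thesis by (rule DERIV_cong) (simp add: mult_ac)
      qed
      from DERIV_add[OF DERIV_cmult[OF this, of "-1"] g(2)[OF u]]
      show "((\<lambda>u. - 1 * (c * Ln u ^ i * polylog ?w u) + g u) has_field_derivative
         c * Ln u ^ i * polylog w u / (u - a)) (at u)"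
        by (rule DERIV_cong) (use au in \<open>simp add: field_simps\<close>)
    qed
  qed
qed

definition log_form :: "(rat \<times> complex) list \<Rightarrow> complex \<Rightarrow> complex" where
  "log_form L u = (\<Sum>(r, a)\<leftarrow>L. of_rat r / (u - a))"

lemma polylog_span_primitive_rform:
  assumes N: "N > 0" and f: "f \<in> polylog_span N b Q k"
    and L: "\<And>a. a \<in> snd ` set L \<Longrightarrow> a = 0 \<and> b \<or> a ^ N = 1 \<and> a \<notin> Q'"
  shows "\<exists>g \<in> polylog_span N b Q' (Suc k). \<forall>u \<in> slit_disc b.
    (g has_field_derivative f u * log_form L u) (at u)"
  using L
proof (induction L)
  case Nil
  then show ?case
    using polylog_span_const[OF CMZV_zero] by (intro bexI[of _ "\<lambda>u. 0"]) (auto simp: log_form_def)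
next
  case (Cons x L)
  obtain r a where x: "x = (r, a)" by (cases x)
  obtain g where g: "g \<in> polylog_span N b Q' (Suc k)"
    "\<And>u. u \<in> slit_disc b \<Longrightarrow> (g has_field_derivative f u / (u - a)) (at u)"
    using polylog_span_primitive[OF N f Cons.prems[of a]] x by auto
  have "\<exists>h \<in> polylog_span N b Q' (Suc k). \<forall>u \<in> slit_disc b.
      (h has_field_derivative f u * log_form L u) (at u)"
    using Cons.prems by (intro Cons.IH) simp
  then obtain h where h: "h \<in> polylog_span N b Q' (Suc k)"
    "\<And>u. u \<in> slit_disc b \<Longrightarrow> (h has_field_derivative f u * log_form L u) (at u)"
    by blast
  show ?case
  proof (intro bexI ballI)
    show "(\<lambda>u. of_rat r * g u + h u) \<in> polylog_span N b Q' (Suc k)"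
      using g h by (intro polylog_span.add polylog_span_scale) auto
    fix u assume "u \<in> slit_disc b"
    from DERIV_add[OF DERIV_cmult[OF g(2)[OF this]] h(2)[OF this]]
    show "((\<lambda>u. of_rat r * g u + h u) has_field_derivative f u * log_form (x # L) u) (at u)"
      by (rule DERIV_cong) (simp add: log_form_def x distrib_left)
  qed
qed

section \<open>Boundary behaviour\<close>

text \<open>This is where closure under products is used: coefficient, power of \<open>Ln p\<close>
  and value at p are multiplied, and their weights add up to k.\<close>

lemma polylog_span_boundary:
  assumes N: "N > 0" and f: "f \<in> polylog_span N b Q k" and p: "p \<in> Q" "p ^ N = 1"
    and b: "b \<Longrightarrow> Ln p \<in> CMZV 1 N \<and> p \<notin> \<real>\<^sub>\<le>\<^sub>0"
  shows "f p \<in> CMZV k N" "(f \<longlongrightarrow> f p) (at p within cball 0 1)"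
proof -
  have "f p \<in> CMZV k N \<and> (f \<longlongrightarrow> f p) (at p within cball 0 1)"
    using f
  proof induction
    case (add f g)
    then show ?case by (auto intro: CMZV_add tendsto_intros)
  next
    case (base c j i w)
    have "polylog w p \<in> CMZV (weight w) N"
      using CMZV_polylog[OF N root_word_mulhd[OF base(3) p(2)] base(4)[OF p(1)]] by (simp add: polylog_mulhd)
    moreover have "Ln p ^ i \<in> CMZV i N"
      using base(2) b CMZV_power[OF N] by (cases "i = 0") (auto simp: CMZV_0)
    ultimately have 1: "c * Ln p ^ i * polylog w p \<in> CMZV k N"
      unfolding base(5) by (intro CMZV_mult N base(1))
    have "w = [] \<or> fst (hd w) \<noteq> 1 \<or> snd (hd w) * p \<noteq> 1"
      using base(4)[OF p(1)] by (cases "(p, w)" rule: scale_hd.cases) (auto simp: convergent_word_def mult.commute)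
    then have 2: "(polylog w \<longlongrightarrow> polylog w p) (at p within cball 0 1)"
      using root_unity_norm[OF N p(2)] polylog_boundary(2)[OF N base(3)] by blast
    have "((\<lambda>u. Ln u ^ i) \<longlongrightarrow> Ln p ^ i) (at p within cball 0 1)"
      using base(2) b by (cases "i = 0") (auto intro!: tendsto_intros)
    with 1 2 show ?case by (auto intro!: tendsto_intros)
  qed
  then show "f p \<in> CMZV k N" "(f \<longlongrightarrow> f p) (at p within cball 0 1)" by auto
qed

text \<open>Coefficients tending to 0 suffice: finitely many terms stay bounded, and the tail is at
  most \<epsilon> / 2 times a geometric series. Convergence at p is not assumed, so heads that are
  singular at p are covered.\<close>

lemma polylog_growth:
  assumes N: "N > 0" and root_word: "root_word N w" and p: "norm p = 1"
  shows "((\<lambda>u. of_real (1 - norm u) * polylog w u) \<longlongrightarrow> 0) (at p within ball 0 1)"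
proof (rule tendstoI)
  fix \<epsilon> :: real assume e: "\<epsilon> > 0"
  obtain K where K: "\<And>n. n \<ge> K \<Longrightarrow> norm (Li_coeff w n) < \<epsilon> / 2"
    using Li_coeff_tendsto_0[OF N root_word] e by (metis LIMSEQ_iff diff_zero half_gt_zero)
  define C where "C = (\<Sum>n<K. norm (Li_coeff w n))"
  have bd: "norm (polylog w u) \<le> C + \<epsilon> / 2 * (1 / (1 - norm u))" if u: "norm u < 1" for u
  proof -
    define g where "g n = (if n < K then norm (Li_coeff w n) else 0) + \<epsilon> / 2 * norm u ^ n" for n
    have le: "norm (Li_coeff w n * u ^ n) \<le> g n" for n
    proof (cases "n < K")
      case True
      have "norm (Li_coeff w n * u ^ n) \<le> norm (Li_coeff w n)"
        using u by (simp add: norm_mult norm_power mult_left_le power_le_one)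
      moreover have "0 \<le> \<epsilon> / 2 * norm u ^ n" using e by simp
      ultimately show ?thesis using True by (simp add: g_def)
    next
      case False
      then show ?thesis using K[of n] e
        by (simp add: g_def norm_mult norm_power mult_right_mono less_imp_le del: divide_const_simps times_divide_eq_left)
    qed
    have "(\<lambda>n. if n < K then norm (Li_coeff w n) else 0) sums C"
      unfolding C_def using sums_If_finite_set[of "{..<K}" "\<lambda>n. norm (Li_coeff w n)"] by simp
    moreover have "(\<lambda>n. \<epsilon> / 2 * norm u ^ n) sums (\<epsilon> / 2 * (1 / (1 - norm u)))"
      using u by (intro sums_mult geometric_sums) auto
    ultimately have "g sums (C + \<epsilon> / 2 * (1 / (1 - norm u)))"
      unfolding g_def[abs_def] by (rule sums_add)
    then show ?thesis
      unfolding polylog_def using norm_suminf_le[of "\<lambda>n. Li_coeff w n * u ^ n" g] le by (simp add: sums_iff)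
  qed
  have "((\<lambda>u. (1 - norm u) * C) \<longlongrightarrow> (1 - norm p) * C) (at p within ball 0 1)"
    by (intro tendsto_intros)
  then have "((\<lambda>u. (1 - norm u) * C) \<longlongrightarrow> 0) (at p within ball 0 1)" by (simp add: p)
  from order_tendstoD(2)[OF this, of "\<epsilon> / 2"] e
  have "\<forall>\<^sub>F u in at p within ball 0 1. (1 - norm u) * C < \<epsilon> / 2" by simp
  moreover have "\<forall>\<^sub>F u in at p within ball 0 1. norm u < 1"
    by (simp add: eventually_at_filter)
  ultimately show "\<forall>\<^sub>F u in at p within ball 0 1. dist (of_real (1 - norm u) * polylog w u) 0 < \<epsilon>"
  proof eventually_elim
    case (elim u)
    have "norm (of_real (1 - norm u) * polylog w u) = (1 - norm u) * norm (polylog w u)"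
      using elim by (simp add: norm_mult del: of_real_diff)
    also have "\<dots> \<le> (1 - norm u) * (C + \<epsilon> / 2 * (1 / (1 - norm u)))"
      using elim by (intro mult_left_mono bd) auto
    also have "\<dots> = (1 - norm u) * C + \<epsilon> / 2" using elim by (simp add: field_simps)
    also have "\<dots> < \<epsilon>" using elim by simp
    finally show ?case by simp
  qed
qed

lemma polylog_span_growth:
  assumes N: "N > 0" and f: "f \<in> polylog_span N b Q k" and p: "norm p = 1" and b: "b \<Longrightarrow> p \<notin> \<real>\<^sub>\<le>\<^sub>0"
  shows "((\<lambda>u. of_real (1 - norm u) * f u) \<longlongrightarrow> 0) (at p within ball 0 1)"
  using f
proof induction
  case (add f g)
  from tendsto_add[OF add(3,4)] show ?case by (simp add: distrib_left)
next
  case (base c j i w)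
  have "((\<lambda>u. Ln u ^ i) \<longlongrightarrow> Ln p ^ i) (at p within ball 0 1)"
    using base(2) b by (cases "i = 0") (auto intro!: tendsto_intros)
  from tendsto_mult[OF tendsto_mult[OF tendsto_const[of c] this] polylog_growth[OF N base(3) p]]
  show ?case by (simp add: mult_ac)
qed

section \<open>Logarithms at roots of unity\<close>

lemma Re_one_minus_pos:
  assumes "norm p = 1" "p \<noteq> 1"
  shows "Re (1 - p) > 0"
proof -
  have "Re p \<le> 1" using assms abs_Re_le_cmod[of p] by auto
  moreover have "Re p \<noteq> 1"
  proof
    assume "Re p = 1"
    with assms(1) have "Im p = 0" by (simp add: cmod_def)
    with \<open>Re p = 1\<close> assms(2) show False by (simp add: complex_eq_iff)
  qed
  ultimately show ?thesis by simp
qed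

text \<open>The value is minus a polylogarithm of depth one. The power series represents the
  logarithm only inside the disc, so both are compared as limits at p, where
  \<open>Ln (1 - u)\<close> is continuous because Re (1 - p) > 0.\<close>

lemma Ln_one_minus_CMZV:
  assumes N: "N > 0" and p: "p ^ N = 1" "p \<noteq> 1"
  shows "Ln (1 - p) \<in> CMZV 1 N"
proof -
  let ?w = "[(1, 1)] :: (nat \<times> complex) list"
  have np: "norm p = 1" using N p(1) by (rule root_unity_norm)
  have "polylog ?w u = - Ln (1 - u)" if "norm u < 1" for u
  proof -
    have "(\<lambda>n. (- 1) ^ Suc n / of_nat n * (- u) ^ n) sums Ln (1 - u)"
      using Ln_series[of "- u"] that by simp
    then have "(\<lambda>n. - ((- 1) ^ Suc n / of_nat n * (- u) ^ n)) sums (- Ln (1 - u))"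
      by (rule sums_minus)
    moreover have "(\<lambda>n. - ((- 1) ^ Suc n / of_nat n * (- u) ^ n)) = (\<lambda>n. Li_coeff ?w n * u ^ n)"
      by (simp add: fun_eq_iff sum_Li_coeff_Nil power_minus[of u])
    ultimately have "(\<lambda>n. Li_coeff ?w n * u ^ n) sums (- Ln (1 - u))" by simp
    then show ?thesis unfolding polylog_def by (rule sums_unique[symmetric])
  qed
  then have "\<forall>\<^sub>F u in at p within ball 0 1. polylog ?w u = - Ln (1 - u)"
    by (simp add: eventually_at_filter)
  moreover have "(polylog ?w \<longlongrightarrow> polylog ?w p) (at p within ball 0 1)"
    by (rule tendsto_within_subset[OF polylog_boundary(2)[OF N _ np] ball_subset_cball]) (use p(2) in auto)
  ultimately have "((\<lambda>u. - Ln (1 - u)) \<longlongrightarrow> polylog ?w p) (at p within ball 0 1)"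
    by (rule Lim_transform_eventually[rotated])
  moreover have "1 - p \<notin> \<real>\<^sub>\<le>\<^sub>0"
    using Re_one_minus_pos[OF np p(2)] by (auto simp: complex_nonpos_Reals_iff)
  then have "((\<lambda>u. - Ln (1 - u)) \<longlongrightarrow> - Ln (1 - p)) (at p within ball 0 1)"
    by (intro tendsto_intros)
  moreover have "at p within ball 0 1 \<noteq> bot"
    using np by (simp add: trivial_limit_within islimpt_ball)
  ultimately have "polylog ?w p = - Ln (1 - p)" using tendsto_unique by blast
  moreover have "polylog ?w p \<in> CMZV 1 N"
    using CMZV_polylog[OF N, of "scale_hd p ?w", unfolded polylog_mulhd] p by (simp add: convergent_word_def)
  ultimately show ?thesis using CMZV_minus[of "- Ln (1 - p)" 1 N] by simp
qed

text \<open>Since -p = (1 - p) / (1 - 1 / p), Ln (-p) is a difference of two known values. Both Ln p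
  and Ln (-p) are rational multiples of pi * \<i>, and Ln (-p) is nonzero because p is not -1; so Ln
  p is a rational multiple of Ln (-p).\<close>

lemma Ln_root_CMZV:
  assumes N: "N > 0" and p: "p ^ N = 1" "p \<noteq> -1"
  shows "Ln p \<in> CMZV 1 N"
proof (cases "p = 1")
  case True
  then show ?thesis by (simp add: CMZV_zero)
next
  case False
  have np: "norm p = 1" using N p(1) by (rule root_unity_norm)
  then have p0: "p \<noteq> 0" by auto
  let ?d = "Ln (1 - p) - Ln (1 - 1 / p)"
  have "?d \<in> CMZV 1 N"
    using p False N by (intro CMZV_diff Ln_one_minus_CMZV) (auto simp: power_divide)
  moreover have d: "Ln (- p) = ?d"
  proof (rule Ln_unique)
    have ne: "1 - p \<noteq> 0" "1 - 1 / p \<noteq> 0" using False p0 by auto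
    then show "exp ?d = - p" using p0 by (simp add: exp_diff field_simps)
    \<comment> \<open>Both arguments lie strictly between -pi / 2 and pi / 2, so their difference
      stays on the principal branch.\<close>
    have "Re (1 - p) > 0" "Re (1 - 1 / p) > 0"
      using False p0 by (intro Re_one_minus_pos; simp add: norm_divide np)+
    then have "\<bar>Im (Ln (1 - p))\<bar> < pi / 2" "\<bar>Im (Ln (1 - 1 / p))\<bar> < pi / 2"
      using ne Re_Ln_pos_lt by blast+
    then show "- pi < Im ?d" "Im ?d \<le> pi" by auto
  qed
  ultimately have mem: "Ln (- p) \<in> CMZV 1 N" by simp
  have "exp (of_nat N * Ln p) = 1" using p p0 by (simp add: exp_of_nat_mult)
  then obtain n :: int where n: "of_nat N * Ln p = of_real (of_int (2 * n) * pi) * \<i>"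
    unfolding exp_eq_1 by (auto simp: complex_eq_iff)
  obtain m :: int where m: "Ln (- p) = Ln p + of_int m * of_real pi * \<i>"
  proof (cases "Im p \<le> 0 \<and> \<not> (Re p < 0 \<and> Im p = 0)")
    case True
    then show ?thesis using that[of 1] Ln_minus[OF p0] by (simp add: mult.commute)
  next
    case False
    then show ?thesis using that[of "-1"] Ln_minus[OF p0] by (simp add: mult.commute)
  qed
  let ?r = "2 * n + int N * m"
  have nm: "of_nat N * Ln (- p) = of_int ?r * (of_real pi * \<i>)"
    unfolding m distrib_left n by (simp add: algebra_simps)
  have "Ln (- p) \<noteq> 0"
  proof
    assume "Ln (- p) = 0"
    then have "- p = 1" using exp_Ln[of "- p"] p0 by simp
    then show False using p(2) by (metis minus_minus)
  qed
  then have r: "(of_int ?r :: complex) \<noteq> 0" using nm N by force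
  have "of_nat N * Ln p = of_nat N * (of_int (2 * n) / of_int ?r * Ln (- p))"
  proof -
    have "of_nat N * (of_int (2 * n) / of_int ?r * Ln (- p)) = of_int (2 * n) / of_int ?r * (of_nat N * Ln (- p))"
      by simp
    also have "\<dots> = of_int (2 * n) * (of_real pi * \<i>)" unfolding nm using r by simp
    finally show ?thesis unfolding n by simp
  qed
  then have "Ln p = of_int (2 * n) / of_int ?r * Ln (- p)" using N by (simp only: mult_cancel_left of_nat_eq_0_iff) auto
  also have "\<dots> \<in> CMZV 1 N" by (intro CMZV_Rats_mult mem Rats_divide Rats_of_int)
  finally show ?thesis .
qed

section \<open>The series with inverse central binomial coefficients\<close>

definition inv_binomial_coeff :: "nat \<Rightarrow> nat \<Rightarrow> complex" where
  "inv_binomial_coeff k n = 1 / (of_nat (2 * n + 1) ^ k * of_nat ((2 * n) choose n))"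

lemma S_series_inv_binomial_coeff: "S_series k v = (\<Sum>n. inv_binomial_coeff k n * v ^ n)"
  by (simp add: S_series_def inv_binomial_coeff_def)

lemma central_binomial_Suc:
  "of_nat ((2 * Suc n) choose Suc n)
     = (2 * of_nat (2 * n + 1) * of_nat ((2 * n) choose n) / of_nat (Suc n) :: 'a :: field_char_0)"
proof -
  have A: "Suc n * (Suc (2 * n) choose n) = Suc (2 * n) * ((2 * n) choose n)"
  proof -
    have "Suc (2 * n) - n = Suc n" by simp
    then have "Suc (2 * n) choose n = Suc (2 * n) choose Suc n"
      using binomial_symmetric[of n "Suc (2 * n)"] by (simp del: binomial_Suc_Suc)
    then show ?thesis using Suc_times_binomial_eq[of "2 * n" n] by (simp only: mult.commute)
  qed
  have "Suc n * ((2 * Suc n) choose Suc n) = (2 * Suc n) * (Suc (2 * n) choose n)"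
  proof -
    have "2 * Suc n = Suc (Suc (2 * n))" by simp
    then show ?thesis using Suc_times_binomial_eq[of "Suc (2 * n)" n] by (simp only: mult.commute)
  qed
  then have "Suc n * ((2 * Suc n) choose Suc n) = 2 * (Suc n * (Suc (2 * n) choose n))"
    by (simp only: mult.assoc)
  then have "Suc n * ((2 * Suc n) choose Suc n) = 2 * ((2 * n + 1) * ((2 * n) choose n))"
    unfolding A by simp
  then have "(of_nat (Suc n * ((2 * Suc n) choose Suc n)) :: 'a) = of_nat (2 * ((2 * n + 1) * ((2 * n) choose n)))"
    by (rule arg_cong)
  then have "of_nat (Suc n) * of_nat ((2 * Suc n) choose Suc n)
      = (2 * of_nat (2 * n + 1) * of_nat ((2 * n) choose n) :: 'a)"
    by (simp only: of_nat_mult of_nat_numeral mult.assoc)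
  then show ?thesis by (subst nonzero_eq_divide_eq[OF of_nat_neq_0]) (simp only: mult.commute)
qed

lemma four_pow_central_binomial: "(4 ^ n / real ((2 * n) choose n))\<^sup>2 \<le> 4 * real n + 1"
proof (induction n)
  case (Suc n)
  define B where "B = real ((2 * n) choose n)"
  define B' where "B' = real ((2 * Suc n) choose Suc n)"
  have B: "B > 0" by (simp add: B_def)
  have B': "B' = 2 * (2 * real n + 1) * B / (real n + 1)"
    unfolding B_def B'_def by (subst central_binomial_Suc) (simp add: add.commute)
  have "4 ^ Suc n / B' = (4 ^ n / B) * ((2 * real n + 2) / (2 * real n + 1))"
  proof -
    have "4 * x / (2 * d * B / m) = (x / B) * (2 * m / d)" if "d > 0" "m > 0" for x d m :: real
      using that B by (simp add: field_simps)
    from this[of "2 * real n + 1" "real n + 1" "4 ^ n"] show ?thesis by (simp add: B')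
  qed
  from arg_cong[OF this, of "\<lambda>x. x\<^sup>2"]
  have "(4 ^ Suc n / B')\<^sup>2 = (4 ^ n / B)\<^sup>2 * ((2 * real n + 2) / (2 * real n + 1))\<^sup>2"
    by (simp only: power_mult_distrib)
  also have "\<dots> \<le> (4 * real n + 1) * ((2 * real n + 2) / (2 * real n + 1))\<^sup>2"
    using Suc unfolding B_def by (intro mult_right_mono) auto
  \<comment> \<open>After clearing denominators the right side exceeds the left by exactly
    1.\<close>
  also have "\<dots> \<le> 4 * real (Suc n) + 1"
    unfolding power_divide
    by (simp add: divide_le_eq) (simp add: power2_eq_square algebra_simps)
  finally show ?case unfolding B'_def .
qed simp

text \<open>By the Wallis-type bound the terms are O(n^(-3/2)) on the circle of radius 4. That
  circle matters: the argument -4 lies on it, and so does 4 sin^2 when the sine is 1 or -1.\<close>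

lemma inv_binomial_coeff_four_summable:
  assumes "k \<ge> 2"
  shows "summable (\<lambda>n. norm (inv_binomial_coeff k n) * 4 ^ n)"
proof (rule summable_comparison_test')
  show "summable (\<lambda>n. 2 * (sqrt (Suc n) / real (Suc n) ^ 2))"
    using summable_ignore_initial_segment[OF summable_n_sqrt, of 1]
    by (intro summable_mult) (simp del: of_nat_Suc)
  fix n :: nat
  have "4 ^ n / real ((2 * n) choose n) \<le> sqrt (4 * real n + 1)"
    using four_pow_central_binomial[of n] by (simp add: real_le_rsqrt)
  also have "\<dots> \<le> sqrt (4 * real (Suc n))" by simp
  also have "\<dots> = 2 * sqrt (Suc n)" by (simp only: real_sqrt_mult real_sqrt_four)
  finally have "4 ^ n / real ((2 * n) choose n) / (2 * real n + 1) ^ k \<le> 2 * sqrt (Suc n) / real (Suc n) ^ 2"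
  proof (intro frac_le)
    have "real (Suc n) ^ 2 \<le> (2 * real n + 1) ^ 2" by (intro power_mono) auto
    also have "\<dots> \<le> (2 * real n + 1) ^ k" using assms by (intro power_increasing) auto
    finally show "real (Suc n) ^ 2 \<le> (2 * real n + 1) ^ k" .
  qed auto
  moreover have "norm (inv_binomial_coeff k n) * 4 ^ n = 4 ^ n / real ((2 * n) choose n) / (2 * real n + 1) ^ k"
  proof -
    have "norm (complex_of_nat (2 * n + 1)) = 2 * real n + 1" by (simp only: norm_of_nat)
    then have "norm (inv_binomial_coeff k n) = 1 / ((2 * real n + 1) ^ k * real ((2 * n) choose n))"
      by (simp only: inv_binomial_coeff_def norm_divide norm_mult norm_power norm_of_nat norm_one)
    then show ?thesis by (simp add: mult.commute)
  qed
  ultimately have "norm (inv_binomial_coeff k n) * 4 ^ n \<le> 2 * sqrt (Suc n) / real (Suc n) ^ 2" by (simp only:)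
  moreover have "norm (norm (inv_binomial_coeff k n) * 4 ^ n) = norm (inv_binomial_coeff k n) * 4 ^ n" by (simp add: abs_mult)
  ultimately show "norm (norm (inv_binomial_coeff k n) * 4 ^ n) \<le> 2 * (sqrt (Suc n) / real (Suc n) ^ 2)"
    by (simp only: times_divide_eq_right)
qed

lemma of_nat_odd_neq_0: "complex_of_nat (2 * n + 1) \<noteq> 0"
  by (simp only: of_nat_eq_0_iff)

lemma inv_binomial_coeff_Suc: "inv_binomial_coeff k n = inv_binomial_coeff (Suc k) n * of_nat (2 * n + 1)"
proof -
  have "1 / (x ^ k * B) = 1 / (x ^ Suc k * B) * x" if "x \<noteq> 0" for x B :: complex
    using that by simp
  from this[OF of_nat_odd_neq_0] show ?thesis unfolding inv_binomial_coeff_def .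
qed

text \<open>For k at least 2 this follows from absolute summability at radius 4. The operator 1 + 2
  v d/dv multiplies the n-th coefficient by 2n + 1, which lowers k without shrinking the disc and so
  reaches k = 1 and k = 0.\<close>

lemma inv_binomial_coeff_summable:
  assumes "norm v < 4"
  shows "summable (\<lambda>n. inv_binomial_coeff k n * v ^ n)"
proof -
  have "summable (\<lambda>n. inv_binomial_coeff k n * v ^ n)" if "k \<ge> 2" "norm v \<le> 4" for k v
  proof (rule summable_comparison_test'[OF inv_binomial_coeff_four_summable[OF that(1)]])
    show "norm (inv_binomial_coeff k n * v ^ n) \<le> norm (inv_binomial_coeff k n) * 4 ^ n" for n
      using that(2) by (simp add: norm_mult norm_power mult_left_mono power_mono)
  qed
  note * = this
  have step: "\<forall>v. norm v < 4 \<longrightarrow> summable (\<lambda>n. inv_binomial_coeff k n * v ^ n)"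
    if IH: "\<forall>v. norm v < 4 \<longrightarrow> summable (\<lambda>n. inv_binomial_coeff (Suc k) n * v ^ n)" for k
  proof (intro allI impI)
    fix v :: complex assume v: "norm v < 4"
    have "summable (\<lambda>n. diffs (inv_binomial_coeff (Suc k)) n * v ^ n)"
      using termdiff_converges[of v 4 "inv_binomial_coeff (Suc k)"] IH v by auto
    then have "summable (\<lambda>n. v * (diffs (inv_binomial_coeff (Suc k)) n * v ^ n))" by (rule summable_mult)
    then have "summable (\<lambda>n. of_nat (Suc n) * inv_binomial_coeff (Suc k) (Suc n) * v ^ Suc n)"
      by (simp add: diffs_def mult_ac)
    then have "summable (\<lambda>n. of_nat n * inv_binomial_coeff (Suc k) n * v ^ n)" by (subst (asm) summable_Suc_iff)
    then have "summable (\<lambda>n. 2 * (of_nat n * inv_binomial_coeff (Suc k) n * v ^ n) + inv_binomial_coeff (Suc k) n * v ^ n)"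
      using IH v by (intro summable_add summable_mult) auto
    moreover have "2 * (of_nat n * inv_binomial_coeff (Suc k) n * v ^ n) + inv_binomial_coeff (Suc k) n * v ^ n = inv_binomial_coeff k n * v ^ n" for n
      by (simp add: inv_binomial_coeff_Suc[of k] algebra_simps)
    ultimately show "summable (\<lambda>n. inv_binomial_coeff k n * v ^ n)" by simp
  qed
  have 2: "\<forall>v. norm v < 4 \<longrightarrow> summable (\<lambda>n. inv_binomial_coeff k n * v ^ n)" if "k \<ge> 2" for k
    using *[OF that] by auto
  have 1: "\<forall>v. norm v < 4 \<longrightarrow> summable (\<lambda>n. inv_binomial_coeff 1 n * v ^ n)" using step[of 1] 2[of 2] by (simp add: numeral_2_eq_2)
  have 0: "\<forall>v. norm v < 4 \<longrightarrow> summable (\<lambda>n. inv_binomial_coeff 0 n * v ^ n)" using step[of 0] 1 by simp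
  consider "k = 0" | "k = 1" | "k \<ge> 2" by linarith
  then show ?thesis using assms 0 1 2 by cases auto
qed

lemma S_series_continuous:
  assumes "k \<ge> 2"
  shows "continuous_on (cball 0 4) (S_series k)"
proof -
  have "uniform_limit (cball 0 4) (\<lambda>n v. \<Sum>i<n. inv_binomial_coeff k i * v ^ i) (\<lambda>v. \<Sum>n. inv_binomial_coeff k n * v ^ n) sequentially"
    by (rule Weierstrass_m_test[OF _ inv_binomial_coeff_four_summable[OF assms]])
      (simp add: norm_mult norm_power mult_left_mono power_mono)
  then have "continuous_on (cball 0 4) (\<lambda>v. \<Sum>n. inv_binomial_coeff k n * v ^ n)"
    by (rule uniform_limit_theorem[rotated]) (auto intro!: always_eventually continuous_intros)
  then show ?thesis by (simp add: S_series_inv_binomial_coeff[abs_def])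
qed

text \<open>With \<open>y = sinh t\<close>, the functions \<open>odd_S k\<close> satisfy \<open>odd_S 1 y = t / cosh t\<close>; in terms of
  \<open>\<theta> = - \<i> t\<close> this is the classical expansion of \<open>arcsin x / sqrt (1 - x\<^sup>2)\<close>.\<close>

definition odd_S :: "nat \<Rightarrow> complex \<Rightarrow> complex" where
  "odd_S k y = y * S_series k (- 4 * y\<^sup>2)"

lemma S_series_deriv:
  assumes "norm v < 4"
  obtains D where "(S_series (Suc k) has_field_derivative D) (at v)"
    "S_series (Suc k) v + 2 * v * D = S_series k v"
proof -
  let ?c = "inv_binomial_coeff (Suc k)"
  have s: "summable (\<lambda>n. ?c n * x ^ n)" if "norm x < 4" for x using that by (rule inv_binomial_coeff_summable)
  define D where "D = (\<Sum>n. diffs ?c n * v ^ n)"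
  have D: "(S_series (Suc k) has_field_derivative D) (at v)"
    unfolding D_def S_series_inv_binomial_coeff[abs_def] using assms s by (intro termdiffs_strong'[of 4]) auto
  have "summable (\<lambda>n. diffs ?c n * v ^ n)"
    using termdiff_converges[of v 4, OF assms s] by auto
  then have "(\<lambda>n. v * (diffs ?c n * v ^ n)) sums (v * D)"
    unfolding D_def by (intro sums_mult summable_sums)
  then have "(\<lambda>n. of_nat (Suc n) * ?c (Suc n) * v ^ Suc n) sums (v * D)"
    by (simp add: diffs_def mult_ac)
  then have "(\<lambda>n. of_nat n * ?c n * v ^ n) sums (v * D)" by (subst (asm) sums_Suc_iff) simp
  then have "(\<lambda>n. ?c n * v ^ n + 2 * (of_nat n * ?c n * v ^ n)) sums (S_series (Suc k) v + 2 * (v * D))"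
    unfolding S_series_inv_binomial_coeff using s[OF assms] by (intro sums_add sums_mult summable_sums)
  moreover have "?c n * v ^ n + 2 * (of_nat n * ?c n * v ^ n) = inv_binomial_coeff k n * v ^ n" for n
    by (simp add: inv_binomial_coeff_Suc[of k] algebra_simps)
  ultimately have "S_series (Suc k) v + 2 * (v * D) = S_series k v"
    by (simp add: S_series_inv_binomial_coeff sums_iff)
  with D that show thesis by (simp add: mult.assoc)
qed

text \<open>Under v = -4 y^2 the operator 1 + 2 v d/dv turns into multiplication by y followed by
  d/dy.\<close>

lemma odd_S_deriv:
  assumes "norm y < 1"
  shows "(odd_S (Suc k) has_field_derivative S_series k (- 4 * y\<^sup>2)) (at y)"
proof -
  have v: "norm (- 4 * y\<^sup>2) < 4" using assms by (simp add: norm_mult norm_power power_less_one_iff abs_square_less_1)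
  obtain D where D: "(S_series (Suc k) has_field_derivative D) (at (- 4 * y\<^sup>2))"
    "S_series (Suc k) (- 4 * y\<^sup>2) + 2 * (- 4 * y\<^sup>2) * D = S_series k (- 4 * y\<^sup>2)"
    using S_series_deriv[OF v] by blast
  have "((\<lambda>y. - 4 * y\<^sup>2) has_field_derivative - 8 * y) (at y)"
    by (auto intro!: derivative_eq_intros)
  from DERIV_mult[OF DERIV_ident DERIV_chain2[OF D(1) this]]
  show ?thesis
    unfolding odd_S_def[abs_def] by (rule DERIV_cong) (use D(2) in \<open>simp add: power2_eq_square algebra_simps\<close>)
qed

text \<open>Writing n + 1 as half of (2n + 1) + 1 in the recursion of the central binomials makes
  the next coefficient for k = 0 a quarter of the sum of the current ones for k = 0 and k =
  1.\<close>

lemma S_series_ode: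
  assumes "norm v < 4"
  shows "(1 - v / 4) * S_series 0 v - v / 4 * S_series 1 v = 1"
proof -
  have s: "(\<lambda>n. inv_binomial_coeff k n * v ^ n) sums S_series k v" for k
    unfolding S_series_inv_binomial_coeff by (intro summable_sums inv_binomial_coeff_summable assms)
  have rec: "inv_binomial_coeff 0 (Suc n) = (inv_binomial_coeff 0 n + inv_binomial_coeff 1 n) / 4" for n
  proof -
    define B where "B = complex_of_nat ((2 * n) choose n)"
    define d where "d = complex_of_nat (2 * n + 1)"
    have nz: "d \<noteq> 0" "1 + complex_of_nat n \<noteq> 0" "B \<noteq> 0"
      using of_nat_odd_neq_0[of n] of_nat_neq_0[of n, where 'a = complex] by (auto simp: d_def B_def)
    have "inv_binomial_coeff 0 (Suc n) = (1 + of_nat n) / (2 * d * B)"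
      unfolding inv_binomial_coeff_def central_binomial_Suc d_def B_def by (simp del: of_nat_add of_nat_mult)
    moreover have "inv_binomial_coeff 0 n = 1 / B" "inv_binomial_coeff 1 n = 1 / (d * B)"
      by (simp_all add: inv_binomial_coeff_def d_def B_def del: of_nat_add of_nat_mult)
    moreover have "(1 / B + 1 / (d * B)) / 4 = (d + 1) / (4 * d * B)"
      using nz by (simp add: field_simps)
    moreover have "1 + of_nat n = (d + 1) / 2" by (simp add: d_def)
    moreover have "(d + 1) / 2 / (2 * d * B) = (d + 1) / (4 * d * B)" by simp
    ultimately show ?thesis by (simp only:)
  qed
  have "(\<lambda>n. v / 4 * (inv_binomial_coeff 0 n * v ^ n + inv_binomial_coeff 1 n * v ^ n)) sums (v / 4 * (S_series 0 v + S_series 1 v))"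
    by (intro sums_mult sums_add s)
  moreover have "v / 4 * (inv_binomial_coeff 0 n * v ^ n + inv_binomial_coeff 1 n * v ^ n) = inv_binomial_coeff 0 (Suc n) * v ^ Suc n" for n
    by (simp add: rec field_simps)
  ultimately have "(\<lambda>n. inv_binomial_coeff 0 (Suc n) * v ^ Suc n) sums (v / 4 * (S_series 0 v + S_series 1 v))"
    by (simp only:)
  then have "(\<lambda>n. inv_binomial_coeff 0 n * v ^ n) sums (v / 4 * (S_series 0 v + S_series 1 v) + 1)"
    by (subst (asm) sums_Suc_iff) (simp add: inv_binomial_coeff_def)
  from sums_unique2[OF this s[of 0]] show ?thesis by (simp add: algebra_simps)
qed

text \<open>The difference \<open>K\<close> of the two sides vanishes at 0 and has derivative 0 by
  the preceding differential equation, because the squared cosine is 1 + y^2. The cosine has no zero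
  here, as y^2 = -1 is excluded inside the disc.\<close>

lemma odd_S_one_Arcsin:
  assumes "norm y < 1"
  shows "odd_S 1 y * cos (Arcsin (- \<i> * y)) = \<i> * Arcsin (- \<i> * y)"
proof -
  define A where "A y = Arcsin (- \<i> * y)" for y
  define K where "K y = odd_S 1 y * cos (A y) - \<i> * A y" for y
  have "(K has_field_derivative 0) (at y)" if y: "norm y < 1" for y
  proof -
    have y': "norm (- \<i> * y) < 1" using y by (simp add: norm_mult)
    have c2: "(cos (A y))\<^sup>2 = 1 + y\<^sup>2"
      unfolding A_def by (simp add: cos_squared_eq power_mult_distrib)
    have "y\<^sup>2 \<noteq> -1"
    proof
      assume "y\<^sup>2 = -1"
      then have "norm y ^ 2 = 1" by (metis norm_minus_cancel norm_one norm_power)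
      then show False using y norm_ge_zero[of y] by (auto simp: power2_eq_1_iff)
    qed
    then have c0: "cos (A y) \<noteq> 0" using c2 by (metis add_eq_0_iff zero_power2 minus_minus)
    have "\<bar>Re (- \<i> * y)\<bar> < 1" using y abs_Im_le_cmod[of y] by simp
    then have a1: "(Arcsin has_field_derivative inverse (cos (Arcsin (- \<i> * y)))) (at (- \<i> * y))"
      by (rule has_field_derivative_Arcsin)
    have a2: "((\<lambda>y. - \<i> * y) has_field_derivative - \<i>) (at y)"
      by (auto intro!: derivative_eq_intros)
    have A: "(A has_field_derivative - \<i> / cos (A y)) (at y)"
      unfolding A_def[abs_def]
      by (rule DERIV_cong[OF DERIV_chain2[of Arcsin _ "\<lambda>y. - \<i> * y" y "- \<i>" UNIV, OF a1 a2]])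
        (simp add: divide_inverse)
    have sA: "sin (A y) = - \<i> * y" by (simp add: A_def)
    have H: "(odd_S 1 has_field_derivative S_series 0 (- 4 * y\<^sup>2)) (at y)"
      using odd_S_deriv[OF y, of 0] by simp
    have "norm (- 4 * y\<^sup>2) < 4" using y by (simp add: norm_mult norm_power power_less_one_iff abs_square_less_1)
    from S_series_ode[OF this]
    have ode: "(1 + y\<^sup>2) * S_series 0 (- 4 * y\<^sup>2) + y * odd_S 1 y = 1"
      by (simp add: odd_S_def power2_eq_square mult_ac)
    have "(K has_field_derivative S_series 0 (- 4 * y\<^sup>2) * cos (A y)
       + (- sin (A y) * (- \<i> / cos (A y))) * odd_S 1 y - \<i> * (- \<i> / cos (A y))) (at y)"
      unfolding K_def[abs_def] by (rule derivative_eq_intros H A refl)+ simp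
    moreover have "S_series 0 (- 4 * y\<^sup>2) * cos (A y)
       + (- sin (A y) * (- \<i> / cos (A y))) * odd_S 1 y - \<i> * (- \<i> / cos (A y))
       = ((cos (A y))\<^sup>2 * S_series 0 (- 4 * y\<^sup>2) + y * odd_S 1 y - 1) / cos (A y)"
      using c0 by (simp add: sA field_simps power2_eq_square)
    ultimately show ?thesis using ode by (simp add: c2)
  qed
  then have "\<exists>c. \<forall>y\<in>ball 0 1. K y = c"
    by (intro has_field_derivative_zero_constant) (auto intro: has_field_derivative_at_within)
  moreover have "K 0 = 0" by (simp add: K_def A_def odd_S_def)
  ultimately have "K y = 0" using assms by (metis centre_in_ball dist_0_norm mem_ball zero_less_one)
  then show ?thesis by (simp add: K_def A_def)
qed

section \<open>Uniformisation by the variable w\<close>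

definition sinh_Ln :: "complex \<Rightarrow> complex" where "sinh_Ln w = (w - 1 / w) / 2"

text \<open>With \<theta> = - \<i> * Ln w, the positive real part of w keeps Re \<theta> between -pi
  / 2 and pi / 2, where \<open>Arcsin\<close> inverts \<open>sin\<close>.\<close>

lemma odd_S_one_hh:
  assumes "Re w > 0" "norm (sinh_Ln w) < 1"
  shows "odd_S 1 (sinh_Ln w) * ((w + 1 / w) / 2) = Ln w"
proof -
  have w: "w \<noteq> 0" using assms by auto
  define \<theta> where "\<theta> = - \<i> * Ln w"
  have e: "exp (\<i> * \<theta>) = w" "exp (- (\<i> * \<theta>)) = 1 / w" using w by (simp_all add: \<theta>_def exp_minus field_simps)
  have "x / (2 * \<i>) = - \<i> * (x / 2)" for x by (simp add: field_simps)
  then have s: "sin \<theta> = - \<i> * sinh_Ln w" and c: "cos \<theta> = (w + 1 / w) / 2"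
    unfolding sin_exp_eq cos_exp_eq e sinh_Ln_def by blast+
  have "\<bar>Re \<theta>\<bar> < pi / 2" using Re_Ln_pos_lt[OF w] assms(1) by (simp add: \<theta>_def)
  then have "Arcsin (sin \<theta>) = \<theta>" by (intro Arcsin_sin) auto
  then show ?thesis
    using odd_S_one_Arcsin[OF assms(2)] unfolding s c[symmetric] by (simp add: \<theta>_def)
qed

definition S_chain :: "nat \<Rightarrow> complex \<Rightarrow> complex" where
  "S_chain j w = (if j = 0 then 1 else if j = 1 then Ln w else odd_S j (sinh_Ln w))"

text \<open>For j > 2 this is the logarithmic derivative of \<open>sinh_Ln\<close>. For j = 2 it is
  1 / (w * sinh_Ln w), which is what remains of that derivative once the factor (w + 1 / w) / 2 from
  \<open>odd_S_one_hh\<close> has cancelled.\<close>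

definition S_form :: "nat \<Rightarrow> complex \<Rightarrow> complex" where
  "S_form j w = (if j = 1 then 1 / w else if j = 2 then 1 / (w - 1) - 1 / (w + 1)
     else 1 / (w - 1) + 1 / (w + 1) - 1 / w)"

lemma sinh_Ln_deriv: "w \<noteq> 0 \<Longrightarrow> (sinh_Ln has_field_derivative (1 + 1 / w\<^sup>2) / 2) (at w)"
  unfolding sinh_Ln_def[abs_def] by (auto intro!: derivative_eq_intros simp: power2_eq_square)

text \<open>Unlike \<open>S_chain_deriv\<close> this includes w = 1, a pole of the forms of index
  above 1. Differentiability there makes the functions of positive index vanish to first order at
  1.\<close>

lemma S_chain_deriv_exists:
  assumes "Re w > 0" "norm (sinh_Ln w) < 1" "j > 0"
  shows "\<exists>D. (S_chain j has_field_derivative D) (at w)"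
proof -
  have w: "w \<noteq> 0" "w \<notin> \<real>\<^sub>\<le>\<^sub>0" using assms by (auto simp: complex_nonpos_Reals_iff)
  show ?thesis
  proof (cases "j = 1")
    case True
    then have "S_chain j = Ln" by (simp add: S_chain_def fun_eq_iff)
    then show ?thesis using has_field_derivative_Ln[OF w(2)] by auto
  next
    case False
    with assms obtain i where j: "j = Suc (Suc i)" by (cases j; cases "j - 1") auto
    have "S_chain j = (\<lambda>w. odd_S (Suc (Suc i)) (sinh_Ln w))" by (simp add: S_chain_def fun_eq_iff j)
    then show ?thesis using DERIV_chain2[OF odd_S_deriv[OF assms(2)] sinh_Ln_deriv[OF w(1)]] by auto
  qed
qed

lemma S_chain_deriv:
  assumes "Re w > 0" "norm (sinh_Ln w) < 1" "w \<noteq> 1"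
  shows "(S_chain (Suc j) has_field_derivative S_chain j w * S_form (Suc j) w) (at w)"
proof -
  have "Re (w + 1) > 0" using assms(1) by simp
  then have "w + 1 \<noteq> 0" by (metis less_irrefl zero_complex.sel(1))
  then have w: "w \<noteq> 0" "w \<notin> \<real>\<^sub>\<le>\<^sub>0" "w - 1 \<noteq> 0" "w + 1 \<noteq> 0"
    using assms by (auto simp: complex_nonpos_Reals_iff)
  have w2: "w\<^sup>2 + 1 \<noteq> 0"
  proof
    assume "w\<^sup>2 + 1 = 0"
    then have "w\<^sup>2 = \<i>\<^sup>2" by (simp add: eq_neg_iff_add_eq_0)
    then have "w = \<i> \<or> w = - \<i>" by (simp only: power2_eq_iff)
    then show False using assms(1) by auto
  qed
  have h0: "sinh_Ln w = (w - 1) * (w + 1) / (2 * w)" using w by (simp add: sinh_Ln_def field_simps)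
  have hf: "S_series i (- 4 * (sinh_Ln w)\<^sup>2) = odd_S i (sinh_Ln w) / sinh_Ln w" for i
    using w by (simp add: odd_S_def h0)
  consider "j = 0" | "j = 1" | "j \<ge> 2" by linarith
  then show ?thesis
  proof cases
    case 1
    then have "S_chain (Suc j) = Ln" by (simp add: S_chain_def fun_eq_iff)
    then show ?thesis
      using has_field_derivative_Ln[OF w(2)] by (simp add: 1 S_chain_def S_form_def divide_inverse)
  next
    case 2
    have "S_chain (Suc j) = (\<lambda>w. odd_S (Suc 1) (sinh_Ln w))" using 2 by (simp add: S_chain_def fun_eq_iff)
    moreover have "S_series 1 (- 4 * (sinh_Ln w)\<^sup>2) * ((1 + 1 / w\<^sup>2) / 2) = S_chain j w * S_form (Suc j) w"
    proof -
      have "odd_S 1 (sinh_Ln w) * (w\<^sup>2 + 1) = odd_S 1 (sinh_Ln w) * ((w + 1 / w) / 2) * (2 * w)"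
        using w by (simp add: field_simps power2_eq_square)
      then have H: "odd_S 1 (sinh_Ln w) = Ln w * (2 * w) / (w\<^sup>2 + 1)"
        using odd_S_one_hh[OF assms(1,2)] w2 by (simp only: eq_divide_eq) simp
      have e: "(1 + 1 / w\<^sup>2) / 2 = (w\<^sup>2 + 1) / (2 * w\<^sup>2)" using w by (simp add: field_simps)
      have "S_form 2 w = 2 / ((w - 1) * (w + 1))" using w by (simp add: S_form_def divide_simps)
      moreover have "L * (2 * w) / c / (a * b / (2 * w)) * (c / (2 * w\<^sup>2)) = L * (2 / (a * b))"
        if "a \<noteq> 0" "b \<noteq> 0" "c \<noteq> 0" for L a b c
        using that w(1) by (simp add: field_simps power2_eq_square)
      ultimately show ?thesis
        unfolding hf unfolding H e unfolding h0 using w w2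
        by (simp add: 2 S_chain_def numeral_2_eq_2[symmetric] del: times_divide_eq_left times_divide_eq_right)
    qed
    ultimately show ?thesis
      using DERIV_chain2[OF odd_S_deriv[OF assms(2), of 1] sinh_Ln_deriv[OF w(1)]] by simp
  next
    case 3
    have "S_chain (Suc j) = (\<lambda>w. odd_S (Suc j) (sinh_Ln w))" using 3 by (simp add: S_chain_def fun_eq_iff)
    moreover have "S_series j (- 4 * (sinh_Ln w)\<^sup>2) * ((1 + 1 / w\<^sup>2) / 2) = S_chain j w * S_form (Suc j) w"
    proof -
      have e: "(1 + 1 / w\<^sup>2) / 2 = (w\<^sup>2 + 1) / (2 * w\<^sup>2)" using w by (simp add: field_simps)
      have o: "S_form (Suc j) w = (w\<^sup>2 + 1) / (w * ((w - 1) * (w + 1)))"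
        using 3 w by (simp add: S_form_def divide_simps) (simp add: algebra_simps power2_eq_square)
      have "odd_S j (sinh_Ln w) / (a * b / (2 * w)) * (c / (2 * w\<^sup>2)) = odd_S j (sinh_Ln w) * (c / (w * (a * b)))"
        if "a \<noteq> 0" "b \<noteq> 0" for a b c
        using that w(1) by (simp add: field_simps power2_eq_square)
      from this[OF w(3,4)] have "odd_S j (sinh_Ln w) / sinh_Ln w * ((1 + 1 / w\<^sup>2) / 2) = odd_S j (sinh_Ln w) * S_form (Suc j) w"
        unfolding e o using h0 by metis
      then show ?thesis unfolding hf using 3 by (simp add: S_chain_def)
    qed
    ultimately show ?thesis
      using DERIV_chain2[OF odd_S_deriv[OF assms(2), of j] sinh_Ln_deriv[OF w(1)]] by simp
  qed
qed

text \<open>The point w0 may correspond to the circle of convergence, so the limit is taken within a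
  set T on which the series converges and rests on continuity on the closed disc.\<close>

lemma S_chain_tendsto:
  assumes "w0 \<notin> \<real>\<^sub>\<le>\<^sub>0" "norm (sinh_Ln w0) \<le> 1" "\<And>x. x \<in> T \<Longrightarrow> norm (sinh_Ln x) \<le> 1"
  shows "(S_chain j \<longlongrightarrow> S_chain j w0) (at w0 within T)"
proof -
  have w: "w0 \<noteq> 0" "w0 \<notin> \<real>\<^sub>\<le>\<^sub>0" using assms by (auto simp: complex_nonpos_Reals_iff)
  consider "j = 0" | "j = 1" | "j \<ge> 2" by linarith
  then show ?thesis
  proof cases
    case 3
    have h: "(sinh_Ln \<longlongrightarrow> sinh_Ln w0) (at w0 within T)"
      unfolding sinh_Ln_def[abs_def] by (intro tendsto_intros) (use w in auto)
    let ?v = "\<lambda>x. - 4 * (sinh_Ln x)\<^sup>2"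
    have "(?v \<longlongrightarrow> ?v w0) (at w0 within T)" by (intro tendsto_intros h)
    moreover have "norm (?v x) \<le> 4" if "norm (sinh_Ln x) \<le> 1" for x
      using that by (simp add: norm_mult norm_power power_le_one)
    ultimately have "((\<lambda>x. S_series j (?v x)) \<longlongrightarrow> S_series j (?v w0)) (at w0 within T)"
      using assms by (intro continuous_on_tendsto_compose[OF S_series_continuous[OF 3]])
        (auto simp: eventually_at_filter)
    from tendsto_mult[OF h this] show ?thesis using 3 by (simp add: S_chain_def[abs_def] odd_S_def)
  qed (use w in \<open>auto simp: S_chain_def[abs_def] intro!: tendsto_intros\<close>)
qed

lemma S_chain_one: "j > 0 \<Longrightarrow> S_chain j 1 = 0"
  by (simp add: S_chain_def sinh_Ln_def odd_S_def)

section \<open>Reversing iterated integrals\<close>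

text \<open>The alternating sum of the products E j * e (k - j) is constant: E meets the forms in
  the opposite order, so differentiating the first or the second factors gives the same terms with
  opposite signs. At 0 only j = 0 survives, at 1 only j = k. The E j with j < k may blow up at 1, so
  the hypothesis there concerns the products.\<close>

lemma iterated_duality:
  fixes E e o' :: "nat \<Rightarrow> real \<Rightarrow> complex"
  assumes E: "\<And>j t. j < k \<Longrightarrow> t \<in> {0<..<1} \<Longrightarrow> (E (Suc j) has_vector_derivative E j t * o' (k - j) t) (at t)"
    and e: "\<And>j t. j < k \<Longrightarrow> t \<in> {0<..<1} \<Longrightarrow> (e (Suc j) has_vector_derivative e j t * o' (Suc j) t) (at t)"
    and 0: "\<And>t. E 0 t = 1" "\<And>t. e 0 t = 1"
    and lim0: "\<And>j. 0 < j \<Longrightarrow> j \<le> k \<Longrightarrow> (E j \<longlongrightarrow> 0) (at_right 0)" "\<And>j. (e j \<longlongrightarrow> \<epsilon> j) (at_right 0)"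
    and lim1: "\<And>j. j < k \<Longrightarrow> ((\<lambda>t. E j t * e (k - j) t) \<longlongrightarrow> 0) (at_left 1)" "(E k \<longlongrightarrow> X) (at_left 1)"
  shows "\<epsilon> k = (- 1) ^ k * X"
proof -
  have E0: "E 0 = (\<lambda>_. 1)" and e0: "e 0 = (\<lambda>_. 1)" using 0 by auto
  define \<Phi> where "\<Phi> t = (\<Sum>j\<le>k. (- 1) ^ j * (E j t * e (k - j) t))" for t
  define dE where "dE j t = (case j of 0 \<Rightarrow> 0 | Suc i \<Rightarrow> E i t * o' (k - i) t)" for j t
  define de where "de j t = (case j of 0 \<Rightarrow> 0 | Suc i \<Rightarrow> e i t * o' (Suc i) t)" for j t
  have "(\<Phi> has_vector_derivative 0) (at t within {0<..<1})" if t: "t \<in> {0<..<1}" for t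
  proof -
    have E': "(E j has_vector_derivative dE j t) (at t)" if "j \<le> k" for j
    proof (cases j)
      case 0
      then show ?thesis by (simp add: dE_def E0)
    next
      case (Suc i)
      then show ?thesis using E[of i t] t that by (simp add: dE_def)
    qed
    have e': "(e j has_vector_derivative de j t) (at t)" if "j \<le> k" for j
    proof (cases j)
      case 0
      then show ?thesis by (simp add: de_def e0)
    next
      case (Suc i)
      then show ?thesis using e[of i t] t that by (simp add: de_def)
    qed
    have "(\<Phi> has_vector_derivative (\<Sum>j\<le>k. (- 1) ^ j * (E j t * de (k - j) t + dE j t * e (k - j) t))) (at t)"
      unfolding \<Phi>_def[abs_def]
      by (intro has_vector_derivative_sum has_vector_derivative_mult_right has_vector_derivative_mult E' e') auto
    also have "(\<Sum>j\<le>k. (- 1) ^ j * (E j t * de (k - j) t + dE j t * e (k - j) t))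
       = (\<Sum>j\<le>k. (- 1) ^ j * (E j t * de (k - j) t)) + (\<Sum>j\<le>k. (- 1) ^ j * (dE j t * e (k - j) t))"
      by (simp add: distrib_left sum.distrib)
    also have "(\<Sum>j\<le>k. (- 1) ^ j * (E j t * de (k - j) t)) = (\<Sum>j<k. (- 1) ^ j * (E j t * de (k - j) t))"
      by (rule sum.mono_neutral_right) (auto simp: de_def)
    also have "\<dots> = (\<Sum>j<k. (- 1) ^ j * (E j t * (e (k - Suc j) t * o' (k - j) t)))"
    proof (rule sum.cong)
      fix j assume "j \<in> {..<k}"
      then have "k - j = Suc (k - Suc j)" by auto
      then show "(- 1) ^ j * (E j t * de (k - j) t) = (- 1) ^ j * (E j t * (e (k - Suc j) t * o' (k - j) t))"
        by (simp add: de_def)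
    qed simp
    also have "(\<Sum>j\<le>k. (- 1) ^ j * (dE j t * e (k - j) t)) = (\<Sum>j<k. (- 1) ^ Suc j * (dE (Suc j) t * e (k - Suc j) t))"
      by (subst sum.atMost_shift) (simp add: dE_def)
    also have "\<dots> = - (\<Sum>j<k. (- 1) ^ j * (E j t * (e (k - Suc j) t * o' (k - j) t)))"
      by (simp add: dE_def sum_negf mult_ac)
    finally show ?thesis by (simp add: has_vector_derivative_at_within)
  qed
  then have "\<exists>c. \<forall>t\<in>{0<..<1}. \<Phi> t = c"
    using has_vector_derivative_zero_constant[of "{0<..<1}" \<Phi>] by (metis convex_real_interval(8))
  then obtain c where c: "\<And>t. t \<in> {0<..<1} \<Longrightarrow> \<Phi> t = c" by blast
  have "(\<Phi> \<longlongrightarrow> (\<Sum>j\<le>k. (- 1) ^ j * ((if j = 0 then 1 else 0) * \<epsilon> (k - j)))) (at_right 0)"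
    unfolding \<Phi>_def[abs_def]
  proof (intro tendsto_intros lim0)
    fix j assume "j \<in> {..k}"
    then show "(E j \<longlongrightarrow> (if j = 0 then 1 else 0)) (at_right 0)"
      using lim0(1)[of j] by (cases "j = 0") (auto simp: E0)
  qed
  moreover have "(\<Sum>j\<le>k. (- 1) ^ j * ((if j = 0 then 1 else 0) * \<epsilon> (k - j))) = \<epsilon> k"
    by (subst sum.mono_neutral_right[of _ "{0}"]) auto
  ultimately have l0: "(\<Phi> \<longlongrightarrow> \<epsilon> k) (at_right 0)" by simp
  have "(\<Phi> \<longlongrightarrow> (\<Sum>j\<le>k. (- 1) ^ j * (if j = k then X else 0))) (at_left 1)"
    unfolding \<Phi>_def[abs_def]
  proof (intro tendsto_intros)
    fix j assume "j \<in> {..k}"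
    then show "((\<lambda>t. E j t * e (k - j) t) \<longlongrightarrow> (if j = k then X else 0)) (at_left 1)"
      using lim1 by (cases "j = k") (auto simp: e0)
  qed
  moreover have "(\<Sum>j\<le>k. (- 1) ^ j * (if j = k then X else 0)) = (- 1) ^ k * X"
    by (subst sum.mono_neutral_right[of _ "{k}"]) auto
  ultimately have l1: "(\<Phi> \<longlongrightarrow> (- 1) ^ k * X) (at_left 1)" by simp
  have "\<forall>\<^sub>F t in at_right (0 :: real). \<Phi> t = c"
    using eventually_at_right_real[of 0 1] by (rule eventually_mono) (use c in auto)
  then have "(\<Phi> \<longlongrightarrow> c) (at_right 0)" by (rule tendsto_eventually)
  then have "\<epsilon> k = c" using l0 tendsto_unique[of "at_right (0 :: real)"] by simp
  have "\<forall>\<^sub>F t in at_left (1 :: real). \<Phi> t = c"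
    using eventually_at_left_real[of 0 1] by (rule eventually_mono) (use c in auto)
  then have "(\<Phi> \<longlongrightarrow> c) (at_left 1)" by (rule tendsto_eventually)
  then have "(- 1) ^ k * X = c" using l1 tendsto_unique[of "at_left (1 :: real)"] by simp
  with \<open>\<epsilon> k = c\<close> show ?thesis by simp
qed

lemma tendsto_within_compose:
  fixes f :: "'a :: t2_space \<Rightarrow> 'b :: topological_space"
  assumes "(f \<longlongrightarrow> f p) (at p within T)" "(g \<longlongrightarrow> p) F" "eventually (\<lambda>t. g t \<in> T) F"
  shows "((\<lambda>t. f (g t)) \<longlongrightarrow> f p) F"
  using assms continuous_within_tendsto_compose[of p T f g F] by (simp add: continuous_within)

text \<open>The path \<open>w\<close> runs from \<open>w0\<close> to 1, and \<open>u\<close> is a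
  coordinate that takes it into the disc; p and q are the images of its ends. The growth condition
  trades the blow-up of the reversed integrals at q against the zero of \<open>S_chain\<close> at
  1.\<close>

lemma S_chain_CMZV:
  fixes w :: "real \<Rightarrow> complex" and u :: "complex \<Rightarrow> complex"
  assumes N: "N > 0"
    and w: "\<And>t. t \<in> {0<..<1} \<Longrightarrow> (w has_vector_derivative w' t) (at t)"
      "\<And>t. t \<in> {0<..<1} \<Longrightarrow> Re (w t) > 0" "\<And>t. t \<in> {0<..<1} \<Longrightarrow> norm (sinh_Ln (w t)) < 1"
      "\<And>t. t \<in> {0<..<1} \<Longrightarrow> w t \<noteq> 1"
    and w_lim: "(w \<longlongrightarrow> w0) (at_right 0)" "(w \<longlongrightarrow> 1) (at_left 1)" "w0 \<notin> \<real>\<^sub>\<le>\<^sub>0" "norm (sinh_Ln w0) \<le> 1"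
    and u: "\<And>t. t \<in> {0<..<1} \<Longrightarrow> (u has_field_derivative u' t) (at (w t))"
      "\<And>t. t \<in> {0<..<1} \<Longrightarrow> u (w t) \<in> slit_disc b"
    and u_lim: "((\<lambda>t. u (w t)) \<longlongrightarrow> p) (at_right 0)" "((\<lambda>t. u (w t)) \<longlongrightarrow> q) (at_left 1)"
    and pq: "p ^ N = 1" "q ^ N = 1"
      "b \<Longrightarrow> Ln p \<in> CMZV 1 N \<and> p \<notin> \<real>\<^sub>\<le>\<^sub>0" "b \<Longrightarrow> Ln q \<in> CMZV 1 N \<and> q \<notin> \<real>\<^sub>\<le>\<^sub>0"
    and L: "\<And>j t. j > 0 \<Longrightarrow> t \<in> {0<..<1} \<Longrightarrow> S_form j (w t) = log_form (L j) (u (w t)) * u' t"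
      "\<And>j a. j > 0 \<Longrightarrow> a \<in> snd ` set (L j) \<Longrightarrow> a = 0 \<and> b \<or> a ^ N = 1 \<and> a \<noteq> p"
      "\<And>a. a \<in> snd ` set (L 1) \<Longrightarrow> a \<noteq> q"
    and growth: "\<forall>\<^sub>F t in at_left 1. norm (w t - 1) \<le> C * (1 - norm (u (w t)))"
  shows "S_chain k w0 \<in> CMZV k N"
proof -
  \<comment> \<open>Forms of index above 1 may have a pole at q, so intermediate primitives need not
    converge there. Only the last one, integrated against the form of index 1, is evaluated at
    q.\<close>
  define Q where "Q j = (if j = k then {p, q} else {p})" for j
  have np: "norm p = 1" "norm q = 1" using pq root_unity_norm[OF N] by auto
  define P where "P j f \<longleftrightarrow> (j \<le> k \<longrightarrow> f \<in> polylog_span N b (Q j) j \<and> (if j = 0 then f = (\<lambda>_. 1) else f p = 0))" for j f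
  define R where "R j f g \<longleftrightarrow> (j < k \<longrightarrow> (\<forall>u\<in>slit_disc b. (g has_field_derivative f u * log_form (L (k - j)) u) (at u)))"
    for j and f g :: "complex \<Rightarrow> complex"
  have "\<exists>F. \<forall>j. P j (F j) \<and> R j (F j) (F (Suc j))"
  proof (rule dependent_nat_choice)
    show "\<exists>f. P 0 f"
      unfolding P_def by (intro exI[of _ "\<lambda>_. 1"]) (auto intro!: polylog_span_const simp: CMZV_0)
  next
    fix f j assume P: "P j f"
    show "\<exists>g. P (Suc j) g \<and> R j f g"
    proof (cases "j < k")
      case True
      then have f: "f \<in> polylog_span N b (Q j) j" using P by (simp add: P_def)
      have "\<exists>g \<in> polylog_span N b (Q (Suc j)) (Suc j). \<forall>u \<in> slit_disc b.
          (g has_field_derivative f u * log_form (L (k - j)) u) (at u)"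
      proof (rule polylog_span_primitive_rform[OF N f])
        fix a assume a: "a \<in> snd ` set (L (k - j))"
        show "a = 0 \<and> b \<or> a ^ N = 1 \<and> a \<notin> Q (Suc j)"
        proof (cases "Suc j = k")
          case True
          then have "k - j = 1" by auto
          with a L(2)[of "k - j" a] L(3)[of a] show ?thesis by (auto simp: Q_def)
        next
          case False
          with a L(2)[of "k - j" a] \<open>j < k\<close> show ?thesis by (auto simp: Q_def)
        qed
      qed
      then obtain g where g: "g \<in> polylog_span N b (Q (Suc j)) (Suc j)"
        "\<And>u. u \<in> slit_disc b \<Longrightarrow> (g has_field_derivative f u * log_form (L (k - j)) u) (at u)" by blast
      \<comment> \<open>Normalising the primitive to vanish at p stays within the span because the
        subtracted constant is itself a value of weight \<open>Suc j\<close>.\<close>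
      have "g p \<in> CMZV (Suc j) N"
        using polylog_span_boundary(1)[OF N g(1), of p] pq by (simp add: Q_def)
      then have "(\<lambda>u. g u + - g p) \<in> polylog_span N b (Q (Suc j)) (Suc j)"
        by (intro polylog_span.add g polylog_span_const CMZV_minus)
      moreover have "((\<lambda>u. g u + - g p) has_field_derivative f u * log_form (L (k - j)) u) (at u)"
        if "u \<in> slit_disc b" for u
        using DERIV_add[OF g(2)[OF that] DERIV_const[of "- g p"]] by simp
      ultimately show ?thesis
        by (intro exI[of _ "\<lambda>u. g u + - g p"]) (auto simp: P_def R_def)
    qed (auto simp: P_def R_def)
  qed
  then obtain F where F: "\<And>j. P j (F j)" "\<And>j. R j (F j) (F (Suc j))" by blast
  have FP: "F j \<in> polylog_span N b (Q j) j" if "j \<le> k" for j using F(1)[of j] that by (simp add: P_def)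
  have F0: "F 0 = (\<lambda>_. 1)" using F(1)[of 0] by (simp add: P_def)
  have Fp: "F j p = 0" if "0 < j" "j \<le> k" for j using F(1)[of j] that by (simp add: P_def)
  have FD: "(F (Suc j) has_field_derivative F j v * log_form (L (k - j)) v) (at v)"
    if "j < k" "v \<in> slit_disc b" for j v using F(2)[of j] that by (simp add: R_def)
  have ev0: "\<forall>\<^sub>F t in at_right (0 :: real). t \<in> {0<..<1}" using eventually_at_right_real[of 0 1] by simp
  have ev1: "\<forall>\<^sub>F t in at_left (1 :: real). t \<in> {0<..<1}" using eventually_at_left_real[of 0 1] by simp
  have nu: "norm (u (w t)) < 1" if "t \<in> {0<..<1}" for t using u(2)[OF that] by (simp add: slit_disc_def)
  have "S_chain k w0 = (- 1) ^ k * F k q"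
  proof (rule iterated_duality[where E = "\<lambda>j t. F j (u (w t))" and e = "\<lambda>j t. S_chain j (w t)"
        and \<epsilon> = "\<lambda>j. S_chain j w0" and o' = "\<lambda>j t. S_form j (w t) * w' t"])
    fix j and t :: real assume j: "j < k" and t: "t \<in> {0<..<1}"
    have "((\<lambda>x. F (Suc j) (u x)) has_field_derivative
        (F j (u (w t)) * log_form (L (k - j)) (u (w t))) * u' t) (at (w t))"
      by (rule DERIV_chain2[OF FD[OF j u(2)[OF t]] u(1)[OF t]])
    from field_vector_diff_chain_at[OF w(1)[OF t] this]
    show "((\<lambda>t. F (Suc j) (u (w t))) has_vector_derivative F j (u (w t)) * (S_form (k - j) (w t) * w' t)) (at t)"
      using L(1)[of "k - j" t] j t by (simp add: o_def mult_ac)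
    from field_vector_diff_chain_at[OF w(1)[OF t] S_chain_deriv[OF w(2)[OF t] w(3)[OF t] w(4)[OF t], of j]]
    show "((\<lambda>t. S_chain (Suc j) (w t)) has_vector_derivative S_chain j (w t) * (S_form (Suc j) (w t) * w' t)) (at t)"
      by (simp add: o_def mult_ac)
  next
    fix j assume j: "0 < j" "j \<le> k"
    have "((\<lambda>t. F j (u (w t))) \<longlongrightarrow> F j p) (at_right 0)"
    proof (rule tendsto_within_compose[OF _ u_lim(1)])
      show "(F j \<longlongrightarrow> F j p) (at p within cball 0 1)"
        by (rule polylog_span_boundary(2)[OF N FP[OF j(2)] _ pq(1,3)]) (auto simp: Q_def)
      show "\<forall>\<^sub>F t in at_right 0. u (w t) \<in> cball 0 1"
        using ev0 by eventually_elim (use nu in \<open>auto intro: less_imp_le\<close>)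
    qed
    then show "((\<lambda>t. F j (u (w t))) \<longlongrightarrow> 0) (at_right 0)" using Fp[OF j] by simp
  next
    fix j
    show "((\<lambda>t. S_chain j (w t)) \<longlongrightarrow> S_chain j w0) (at_right 0)"
    proof (rule tendsto_within_compose[OF _ w_lim(1)])
      show "(S_chain j \<longlongrightarrow> S_chain j w0) (at w0 within {x. norm (sinh_Ln x) \<le> 1})"
        using w_lim by (intro S_chain_tendsto) auto
      show "\<forall>\<^sub>F t in at_right 0. w t \<in> {x. norm (sinh_Ln x) \<le> 1}"
        using ev0 by eventually_elim (use w(3) in \<open>auto intro: less_imp_le\<close>)
    qed
  next
    show "((\<lambda>t. F k (u (w t))) \<longlongrightarrow> F k q) (at_left 1)"
    proof (rule tendsto_within_compose[OF _ u_lim(2)])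
      show "(F k \<longlongrightarrow> F k q) (at q within cball 0 1)"
        by (rule polylog_span_boundary(2)[OF N FP[of k] _ pq(2,4)]) (auto simp: Q_def)
      show "\<forall>\<^sub>F t in at_left 1. u (w t) \<in> cball 0 1"
        using ev1 by eventually_elim (use nu in \<open>auto intro: less_imp_le\<close>)
    qed
  next
    fix j assume j: "j < k"
    \<comment> \<open>The quotient of \<open>S_chain (k - j)\<close> by w - 1 converges, and 1 -
      norm u times the reversed integral tends to 0; \<open>growth\<close> links the two
      scales.\<close>
    obtain D where "(S_chain (k - j) has_field_derivative D) (at 1)"
      using S_chain_deriv_exists[of 1 "k - j"] j by (auto simp: sinh_Ln_def)
    then have "((\<lambda>x. (S_chain (k - j) x - S_chain (k - j) 1) / (x - 1)) \<longlongrightarrow> D) (at 1)"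
      by (simp add: has_field_derivative_iff)
    then have D: "((\<lambda>x. S_chain (k - j) x / (x - 1)) \<longlongrightarrow> D) (at 1)"
      using j by (simp add: S_chain_one)
    have "filterlim w (at 1) (at_left 1)"
      using w_lim(2) ev1 w(4) unfolding filterlim_at by (auto elim: eventually_mono)
    from filterlim_compose[OF D this]
    have l1: "((\<lambda>t. S_chain (k - j) (w t) / (w t - 1)) \<longlongrightarrow> D) (at_left 1)" .
    have "\<forall>\<^sub>F t in at_left 1. u (w t) \<in> ball 0 1 \<and> u (w t) \<noteq> q"
      using ev1
    proof eventually_elim
      case (elim t)
      then show ?case using nu[of t] np by auto
    qed
    then have "filterlim (\<lambda>t. u (w t)) (at q within ball 0 1) (at_left 1)"
      using u_lim(2) unfolding filterlim_at by blast
    from filterlim_compose[OF polylog_span_growth[OF N FP[OF less_imp_le[OF j]] np(2)] this] pq(4)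
    have l2: "((\<lambda>t. of_real (1 - norm (u (w t))) * F j (u (w t))) \<longlongrightarrow> 0) (at_left 1)" by blast
    have "((\<lambda>t. norm (of_real (1 - norm (u (w t))) * F j (u (w t))) * C * norm (S_chain (k - j) (w t) / (w t - 1)))
       \<longlongrightarrow> norm (0 :: complex) * C * norm D) (at_left 1)"
      by (intro tendsto_intros l1 l2)
    then have "((\<lambda>t. norm (of_real (1 - norm (u (w t))) * F j (u (w t))) * C * norm (S_chain (k - j) (w t) / (w t - 1)))
       \<longlongrightarrow> 0) (at_left 1)" by simp
    then show "((\<lambda>t. F j (u (w t)) * S_chain (k - j) (w t)) \<longlongrightarrow> 0) (at_left 1)"
    proof (rule Lim_null_comparison[rotated])
      show "\<forall>\<^sub>F t in at_left 1. norm (F j (u (w t)) * S_chain (k - j) (w t)) \<le>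
        norm (of_real (1 - norm (u (w t))) * F j (u (w t))) * C * norm (S_chain (k - j) (w t) / (w t - 1))"
        using ev1 growth
      proof eventually_elim
        case (elim t)
        define x where "x = norm (F j (u (w t))) * norm (S_chain (k - j) (w t) / (w t - 1))"
        have w1: "w t \<noteq> 1" using w(4) elim by blast
        have "norm (F j (u (w t)) * S_chain (k - j) (w t)) = x * norm (w t - 1)"
          using w1 by (simp add: x_def norm_mult norm_divide)
        also have "\<dots> \<le> x * (C * (1 - norm (u (w t))))"
          using elim by (intro mult_left_mono) (auto simp: x_def)
        also have "norm (complex_of_real (1 - norm (u (w t)))) = 1 - norm (u (w t))"
          using nu[of t] elim(1) by (simp only: norm_of_real) simp
        then have "x * (C * (1 - norm (u (w t)))) =
          norm (of_real (1 - norm (u (w t))) * F j (u (w t))) * C * norm (S_chain (k - j) (w t) / (w t - 1))"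
          unfolding norm_mult x_def by (simp only: mult_ac)
        finally show ?case .
      qed
    qed
  qed (auto simp: F0 S_chain_def)
  moreover have "F k q \<in> CMZV k N"
    using polylog_span_boundary(1)[OF N FP[of k], of q] pq by (simp add: Q_def)
  ultimately show ?thesis by (simp add: CMZV_Rats_mult)
qed

section \<open>Values at roots of unity\<close>

lemma norm_hh_squared:
  assumes "w \<noteq> 0"
  shows "(norm (sinh_Ln w))\<^sup>2 = (((norm w)\<^sup>2 + 1)\<^sup>2 - 4 * (Re w)\<^sup>2) / (4 * (norm w)\<^sup>2)"
proof -
  have "sinh_Ln w = (w\<^sup>2 - 1) / (2 * w)" using assms by (simp add: sinh_Ln_def field_simps power2_eq_square)
  then have "(norm (sinh_Ln w))\<^sup>2 = (norm (w\<^sup>2 - 1))\<^sup>2 / (4 * (norm w)\<^sup>2)"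
    by (simp add: norm_divide norm_mult power_divide power_mult_distrib)
  also have "(norm (w\<^sup>2 - 1))\<^sup>2 = ((norm w)\<^sup>2 + 1)\<^sup>2 - 4 * (Re w)\<^sup>2"
    unfolding cmod_power2 by (simp add: power2_eq_square algebra_simps)
  finally show ?thesis .
qed

text \<open>The bound amounts to (|w|^2 - 1)^2 \<le> (2 Re w)^2. For Re w \<ge> 0 this is the closed
  disc of radius sqrt 2 about 1 without the open disc of radius sqrt 2 about -1.\<close>

lemma norm_hh_le:
  assumes "w \<noteq> 0" "\<bar>(norm w)\<^sup>2 - 1\<bar> \<le> 2 * Re w"
  shows "norm (sinh_Ln w) \<le> 1"
proof -
  have "((norm w)\<^sup>2 - 1)\<^sup>2 \<le> (2 * Re w)\<^sup>2" using power_mono[OF assms(2) abs_ge_zero, of 2] by simp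
  then have "((norm w)\<^sup>2 + 1)\<^sup>2 - 4 * (Re w)\<^sup>2 \<le> 4 * (norm w)\<^sup>2"
    by (simp add: power2_eq_square algebra_simps)
  then have "(norm (sinh_Ln w))\<^sup>2 \<le> 1" using assms(1) by (simp add: norm_hh_squared divide_le_eq)
  then show ?thesis by (simp add: power_le_one_iff abs_square_le_1)
qed

lemma norm_hh_less:
  assumes "w \<noteq> 0" "\<bar>(norm w)\<^sup>2 - 1\<bar> < 2 * Re w"
  shows "norm (sinh_Ln w) < 1"
proof -
  have "((norm w)\<^sup>2 - 1)\<^sup>2 < (2 * Re w)\<^sup>2"
    using power_strict_mono[OF assms(2) abs_ge_zero, of 2] by simp
  then have "((norm w)\<^sup>2 + 1)\<^sup>2 - 4 * (Re w)\<^sup>2 < 4 * (norm w)\<^sup>2"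
    by (simp add: power2_eq_square algebra_simps)
  then have "(norm (sinh_Ln w))\<^sup>2 < 1" using assms(1) by (simp add: norm_hh_squared divide_less_eq)
  then show ?thesis by (simp add: power_less_one_iff abs_square_less_1)
qed

text \<open>The path is the chord from w0 to 1, with u the identity. The pole 0 lies inside the
  disc, hence the powers of \<open>Ln\<close>; the pole -1 must be an N-th root of unity, hence the
  least common multiple with 2. Re w0 \<ge> 0 keeps the chord in the right half plane.\<close>

lemma S_chain_root_CMZV:
  assumes N: "N > 0" and w0: "w0 ^ N = 1" "Re w0 \<ge> 0" "Im w0 \<noteq> 0" and N2: "(- 1 :: complex) ^ N = 1"
  shows "S_chain k w0 \<in> CMZV k N"
proof -
  define x y where "x = Re w0" and "y = Im w0"
  have nw0: "norm w0 = 1" using N w0(1) by (rule root_unity_norm)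
  then have xy: "x\<^sup>2 + y\<^sup>2 = 1" by (simp add: x_def y_def cmod_def)
  have y0: "y\<^sup>2 > 0" using w0 by (simp add: y_def)
  have "x\<^sup>2 < 1" using xy y0 by linarith
  then have x: "0 \<le> x" "x < 1"
    using w0(2) abs_square_less_1[of x] by (auto simp: x_def)
  define w where "w t = w0 + of_real t * (1 - w0)" for t
  have Rw: "Re (w t) = x + t * (1 - x)" and Iw: "Im (w t) = (1 - t) * y" for t
    by (simp_all add: w_def x_def y_def algebra_simps)
  have nw: "(norm (w t))\<^sup>2 = 1 - 2 * (t * (1 - t) * (1 - x))" for t
  proof -
    have "(norm (w t))\<^sup>2 = (x + t * (1 - x))\<^sup>2 + (1 - t)\<^sup>2 * y\<^sup>2"
      by (simp add: cmod_power2 Rw Iw power_mult_distrib)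
    also have "y\<^sup>2 = 1 - x\<^sup>2" using xy by simp
    finally show ?thesis by (simp add: power2_eq_square algebra_simps)
  qed
  have d: "w t - 1 = of_real (1 - t) * (w0 - 1)" for t by (simp add: w_def algebra_simps)
  define c where "c = norm (w0 - 1)"
  have c2: "c\<^sup>2 = 2 - 2 * x"
  proof -
    have "c\<^sup>2 = (x - 1)\<^sup>2 + y\<^sup>2" by (simp add: c_def cmod_power2 x_def y_def)
    also have "y\<^sup>2 = 1 - x\<^sup>2" using xy by simp
    finally show ?thesis by (simp add: power2_eq_square algebra_simps)
  qed
  have c: "c > 0" using w0 by (auto simp: c_def)
  have Rpos: "Re (w t) > 0" if "t \<in> {0<..<1}" for t
    unfolding Rw using x that by (intro add_nonneg_pos mult_pos_pos) auto
  have nlt: "norm (w t) < 1" if "t \<in> {0<..<1}" for t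
  proof -
    have "t * (1 - t) * (1 - x) > 0" using that x by auto
    then have "(norm (w t))\<^sup>2 < 1" by (simp add: nw)
    then show ?thesis by (simp add: abs_square_less_1)
  qed
  define L :: "nat \<Rightarrow> (rat \<times> complex) list" where
    "L j = (if j = 1 then [(1, 0)] else if j = 2 then [(1, 1), (- 1, - 1)] else [(1, 1), (1, - 1), (- 1, 0)])" for j
  have w0': "w0 \<noteq> 0" "w0 \<noteq> 1" "w0 \<noteq> - 1" "w0 \<notin> \<real>\<^sub>\<le>\<^sub>0"
    using w0 by (auto simp: complex_nonpos_Reals_iff)
  have lim: "(w \<longlongrightarrow> w0) (at_right 0)" "(w \<longlongrightarrow> 1) (at_left 1)"
  proof -
    have "(w \<longlongrightarrow> w0 + of_real 0 * (1 - w0)) (at_right 0)" "(w \<longlongrightarrow> w0 + of_real 1 * (1 - w0)) (at_left 1)"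
      unfolding w_def[abs_def] by (intro tendsto_intros)+
    then show "(w \<longlongrightarrow> w0) (at_right 0)" "(w \<longlongrightarrow> 1) (at_left 1)" by simp_all
  qed
  show ?thesis
  proof (rule S_chain_CMZV[where w = w and u = "\<lambda>u. u" and L = L and b = True and C = "4 / c"
        and p = w0 and q = 1 and u' = "\<lambda>_. 1" and w' = "\<lambda>_. 1 - w0"])
    fix t :: real assume t: "t \<in> {0<..<1}"
    show "(w has_vector_derivative 1 - w0) (at t)"
      unfolding w_def[abs_def] by (auto intro!: derivative_eq_intros)
    show "Re (w t) > 0" using Rpos[OF t] .
    then have "w t \<noteq> 0" "w t \<notin> \<real>\<^sub>\<le>\<^sub>0" by (auto simp: complex_nonpos_Reals_iff)
    have "t * (1 - x) * t > 0" using x t by auto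
    then have "t * (1 - t) * (1 - x) < t * (1 - x)" by (simp add: algebra_simps)
    moreover have "t * (1 - t) * (1 - x) > 0" using t x by auto
    ultimately have "\<bar>(norm (w t))\<^sup>2 - 1\<bar> < 2 * Re (w t)" using x(1) unfolding nw Rw by simp
    then show "norm (sinh_Ln (w t)) < 1" using \<open>w t \<noteq> 0\<close> by (intro norm_hh_less)
    show "w t \<noteq> 1" using nlt[OF t] by auto
    show "w t \<in> slit_disc True" using nlt[OF t] \<open>w t \<notin> \<real>\<^sub>\<le>\<^sub>0\<close> by (simp add: slit_disc_def)
  next
    show "norm (sinh_Ln w0) \<le> 1" using w0(2) w0' nw0 by (intro norm_hh_le) auto
    \<comment> \<open>On the chord 1 - |w|^2 = t (1 - t) c^2. For t \<ge> 1/2 this gives 1 - |w|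
      \<ge> (1 - t) c^2 / 4, while |w - 1| = (1 - t) c; the quotient is 4 / c.\<close>
    show "\<forall>\<^sub>F t in at_left 1. norm (w t - 1) \<le> 4 / c * (1 - norm (w t))"
      using eventually_at_left_real[of "1 / 2" "1 :: real", simplified]
    proof eventually_elim
      case (elim t)
      then have t: "t \<in> {0<..<1}" "t \<ge> 1 / 2" by auto
      have "(1 - t) * c\<^sup>2 / 2 \<le> t * (1 - t) * c\<^sup>2"
        using mult_right_mono[OF t(2), of "(1 - t) * c\<^sup>2"] t(1) by simp
      also have "\<dots> = 1 - (norm (w t))\<^sup>2" unfolding nw c2 by (simp add: algebra_simps)
      also have "\<dots> = (1 - norm (w t)) * (1 + norm (w t))" by (simp add: power2_eq_square algebra_simps)
      also have "\<dots> \<le> (1 - norm (w t)) * 2" using nlt[OF t(1)] by (intro mult_left_mono) auto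
      finally have "(1 - t) * c\<^sup>2 \<le> 4 * (1 - norm (w t))" by simp
      then have "(1 - t) * c \<le> 4 / c * (1 - norm (w t))"
        using c by (simp add: field_simps power2_eq_square)
      moreover have "norm (w t - 1) = (1 - t) * c"
        unfolding d norm_mult c_def using t(1) by (simp only: norm_of_real) simp
      ultimately show ?case by simp
    qed
    show "Ln w0 \<in> CMZV 1 N \<and> w0 \<notin> \<real>\<^sub>\<le>\<^sub>0" using Ln_root_CMZV[OF N w0(1) w0'(3)] w0'(4) by simp
    show "Ln 1 \<in> CMZV 1 N \<and> (1 :: complex) \<notin> \<real>\<^sub>\<le>\<^sub>0" by (simp add: CMZV_zero)
  qed (use N w0 w0' N2 lim in \<open>auto simp: L_def S_form_def log_form_def split: if_splits intro!: derivative_eq_intros\<close>)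
qed

text \<open>Cross-multiplication leaves (x - y) * (\<beta> - cnj \<beta>). The second claim is
  injectivity at infinity, whose image is 1.\<close>

lemma conj_quotient_inj:
  fixes x y :: real
  assumes "Im \<beta> \<noteq> 0"
  shows "(of_real x - \<beta>) / (of_real x - cnj \<beta>) = (of_real y - \<beta>) / (of_real y - cnj \<beta>) \<longleftrightarrow> x = y"
    and "(of_real x - \<beta>) / (of_real x - cnj \<beta>) \<noteq> 1"
proof -
  have nz: "of_real r - cnj \<beta> \<noteq> 0" for r :: real using assms by (auto simp: complex_eq_iff)
  have b: "\<beta> - cnj \<beta> \<noteq> 0" using assms by (auto simp: complex_eq_iff)
  show "(of_real x - \<beta>) / (of_real x - cnj \<beta>) \<noteq> 1"
    using nz[of x] b by (simp add: divide_eq_eq)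
  have "(of_real x - \<beta>) * (of_real y - cnj \<beta>) - (of_real y - \<beta>) * (of_real x - cnj \<beta>)
     = (of_real x - of_real y) * (\<beta> - cnj \<beta>)" by (simp add: algebra_simps)
  then have "(of_real x - \<beta>) * (of_real y - cnj \<beta>) = (of_real y - \<beta>) * (of_real x - cnj \<beta>) \<longleftrightarrow> x = y"
    using b by (auto simp: eq_iff_diff_eq_0[of "(of_real x - \<beta>) * (of_real y - cnj \<beta>)"])
  then show "(of_real x - \<beta>) / (of_real x - cnj \<beta>) = (of_real y - \<beta>) / (of_real y - cnj \<beta>) \<longleftrightarrow> x = y"
    using nz by (simp add: frac_eq_eq)
qed

text \<open>The Cayley transform with pole \<open>cnj \<beta>\<close> maps the upper half plane to the unit disc; the
  singular points \<open>0\<close>, \<open>1\<close>, \<open>- 1\<close>, \<open>\<infinity>\<close> and the base point \<open>a\<close> go to roots of unity.\<close>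

lemma S_chain_real_CMZV:
  fixes a :: real and \<beta> :: complex
  defines "A \<equiv> \<lambda>x :: real. (of_real x - \<beta>) / (of_real x - cnj \<beta>)"
  assumes N: "N > 0" and a: "0 < a" "a < 1" "1 \<le> a\<^sup>2 + 2 * a" and \<beta>: "Im \<beta> > 0"
    and A: "A 0 ^ N = 1" "A 1 ^ N = 1" "A (- 1) ^ N = 1" "A a ^ N = 1"
  shows "S_chain k (of_real a) \<in> CMZV k N"
proof -
  \<comment> \<open>The transform maps the real segment into the unit circle, so the path is a
    parabolic arc above it. Its nonzero slope at 1 keeps the image from being tangent to the
    circle.\<close>
  define w where "w t = of_real (a + t * (1 - a)) + \<i> * of_real (t * (1 - t))" for t :: real
  define u where "u w = (w - \<beta>) / (w - cnj \<beta>)" for w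
  have Rw: "Re (w t) = a + t * (1 - a)" and Iw: "Im (w t) = t * (1 - t)" for t
    by (simp_all add: w_def)
  have uA: "u (of_real r) = A r" for r by (simp add: u_def A_def)
  \<comment> \<open>The form dx / (x - r) becomes du / (u - A r) - du / (u - 1), where 1 is the
    image of infinity. For index 2 the terms at 1 cancel.\<close>
  define L :: "nat \<Rightarrow> (rat \<times> complex) list" where
    "L j = (if j = 1 then [(1, A 0), (- 1, 1)] else if j = 2 then [(1, A 1), (- 1, A (- 1))]
      else [(1, A 1), (1, A (- 1)), (- 1, A 0), (- 1, 1)])" for j
  have inj: "A r = A s \<longleftrightarrow> r = s" and A1: "A r \<noteq> 1" for r s
    unfolding A_def using conj_quotient_inj \<beta> by auto
  have nz: "w t - cnj \<beta> \<noteq> 0" if "t \<in> {0<..<1}" for t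
  proof -
    have "Im (w t - cnj \<beta>) > 0" using that \<beta> by (simp add: Iw add_pos_pos)
    then show ?thesis by auto
  qed
  define B where "B = 2 + norm \<beta>"
  have nw: "(norm (w t))\<^sup>2 = (a + t * (1 - a))\<^sup>2 + (t * (1 - t))\<^sup>2" for t
    by (simp add: cmod_power2 Rw Iw)
  have bd: "a < Re (w t)" "Re (w t) < 1" "0 < Im (w t)" "Im (w t) < 1" if "t \<in> {0<..<1}" for t
  proof -
    show "a < Re (w t)" using that a by (simp add: Rw)
    have "(1 - t) * (1 - a) > 0" using that a by auto
    then show "Re (w t) < 1" by (simp add: Rw algebra_simps)
    show "0 < Im (w t)" using that by (simp add: Iw)
    have "t * (1 - t) < 1 * 1" using that by (intro mult_strict_mono) auto
    then show "Im (w t) < 1" by (simp add: Iw)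
  qed
  have norm_u: "1 - (norm (u (w t)))\<^sup>2 = 4 * Im (w t) * Im \<beta> / (norm (w t - cnj \<beta>))\<^sup>2" if "t \<in> {0<..<1}" for t
  proof -
    have "(norm (w t - cnj \<beta>))\<^sup>2 - (norm (w t - \<beta>))\<^sup>2 = 4 * Im (w t) * Im \<beta>"
      unfolding cmod_power2 by (simp add: power2_eq_square algebra_simps)
    then have "(norm (w t - \<beta>))\<^sup>2 = (norm (w t - cnj \<beta>))\<^sup>2 - 4 * Im (w t) * Im \<beta>" by simp
    moreover have "(norm (u (w t)))\<^sup>2 = (norm (w t - \<beta>))\<^sup>2 / (norm (w t - cnj \<beta>))\<^sup>2"
      by (simp add: u_def norm_divide power_divide)
    moreover have "norm (w t - cnj \<beta>) \<noteq> 0" using nz[OF that] by simp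
    ultimately show ?thesis by (simp add: field_simps)
  qed
  have nlt: "norm (u (w t)) < 1" if "t \<in> {0<..<1}" for t
  proof -
    have "4 * Im (w t) * Im \<beta> / (norm (w t - cnj \<beta>))\<^sup>2 > 0"
      using bd[OF that] \<beta> nz[OF that] by auto
    then have "(norm (u (w t)))\<^sup>2 < 1" using norm_u[OF that] by linarith
    then show ?thesis by (simp add: abs_square_less_1)
  qed
  have w_lim: "(w \<longlongrightarrow> of_real a) (at_right 0)" "(w \<longlongrightarrow> 1) (at_left 1)"
  proof -
    have "(w \<longlongrightarrow> of_real (a + 0 * (1 - a)) + \<i> * of_real (0 * (1 - 0))) (at_right 0)"
      "(w \<longlongrightarrow> of_real (a + 1 * (1 - a)) + \<i> * of_real (1 * (1 - 1))) (at_left 1)"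
      unfolding w_def[abs_def] by (intro tendsto_intros)+
    then show "(w \<longlongrightarrow> of_real a) (at_right 0)" "(w \<longlongrightarrow> 1) (at_left 1)" by simp_all
  qed
  have nzr: "of_real r - cnj \<beta> \<noteq> 0" for r :: real using \<beta> by (auto simp: complex_eq_iff)
  show ?thesis
  proof (rule S_chain_CMZV[where w = w and u = u and L = L and b = False and C = "2 * B\<^sup>2 / Im \<beta>"
        and p = "A a" and q = "A 1" and u' = "\<lambda>t. (\<beta> - cnj \<beta>) / (w t - cnj \<beta>)\<^sup>2"
        and w' = "\<lambda>t. of_real (1 - a) + \<i> * of_real (1 - 2 * t)"])
    show "N > 0" by (rule N)
    fix t :: real assume t: "t \<in> {0<..<1}"
    note bd = bd[OF t]
    show "(w has_vector_derivative of_real (1 - a) + \<i> * of_real (1 - 2 * t)) (at t)"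
      unfolding w_def[abs_def] has_vector_derivative_complex_iff
      by (auto intro!: derivative_eq_intros simp: algebra_simps)
    show "Re (w t) > 0" using bd a by simp
    then have w0: "w t \<noteq> 0" by auto
    \<comment> \<open>The hypothesis 1 \<le> a^2 + 2 a says that |sinh_Ln a| \<le> 1. It yields one
      inequality because Re (w t) > a; the other holds because |w|^2 - 1 is at most Re (w
      t).\<close>
    have "\<bar>(norm (w t))\<^sup>2 - 1\<bar> < 2 * Re (w t)"
    proof -
      have n: "(norm (w t))\<^sup>2 = (Re (w t))\<^sup>2 + (Im (w t))\<^sup>2" by (rule cmod_power2)
      have "a\<^sup>2 < (Re (w t))\<^sup>2" using bd a by (intro power_strict_mono) auto
      moreover have "0 \<le> (Im (w t))\<^sup>2" by simp
      moreover have "(Im (w t))\<^sup>2 \<le> 1" using bd by (intro power_le_one) auto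
      moreover have "(Re (w t))\<^sup>2 \<le> Re (w t)"
        using bd a unfolding power2_eq_square by (intro mult_left_le) auto
      ultimately show ?thesis using a bd unfolding n abs_less_iff by linarith
    qed
    then show "norm (sinh_Ln (w t)) < 1" by (rule norm_hh_less[OF w0])
    show w1: "w t \<noteq> 1" using bd by auto
    have "w t + 1 \<noteq> 0"
    proof
      assume "w t + 1 = 0"
      then have "Re (w t + 1) = 0" by simp
      then show False using bd a by simp
    qed
    show "(u has_field_derivative (\<beta> - cnj \<beta>) / (w t - cnj \<beta>)\<^sup>2) (at (w t))"
      unfolding u_def[abs_def] using nz[OF t]
      by (auto intro!: derivative_eq_intros simp: power2_eq_square)
    show "u (w t) \<in> slit_disc False" using nlt[OF t] by (simp add: slit_disc_def)
    have b0: "\<beta> - cnj \<beta> \<noteq> 0" using \<beta> by (auto simp: complex_eq_iff)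
    let ?v = "w t - cnj \<beta>"
    have v: "?v \<noteq> 0" by (rule nz[OF t])
    have f1: "1 / (u (w t) - 1) * ((\<beta> - cnj \<beta>) / ?v\<^sup>2) = - 1 / ?v"
    proof -
      have eq: "u (w t) - 1 = - (\<beta> - cnj \<beta>) / ?v" using v by (simp add: u_def field_simps)
      have "1 / (- d / v) * (d / v\<^sup>2) = - 1 / v" if "d \<noteq> 0" "v \<noteq> 0" for d v :: complex
        using that by (simp add: power2_eq_square)
      from this[OF b0 v] show ?thesis unfolding eq .
    qed
    have fA: "1 / (u (w t) - A r) * ((\<beta> - cnj \<beta>) / ?v\<^sup>2) = 1 / (w t - of_real r) - 1 / ?v"
      if "w t - of_real r \<noteq> 0" for r
    proof -
      have "u (w t) - A r = (w t - of_real r) * (\<beta> - cnj \<beta>) / (?v * (of_real r - cnj \<beta>))"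
        using v nzr[of r] by (simp add: u_def A_def diff_frac_eq) (simp add: algebra_simps)
      then have "1 / (u (w t) - A r) * ((\<beta> - cnj \<beta>) / ?v\<^sup>2) = (of_real r - cnj \<beta>) / ((w t - of_real r) * ?v)"
        using b0 v by (simp add: power2_eq_square)
      also have "\<dots> = 1 / (w t - of_real r) - 1 / ?v"
        using v that by (simp add: diff_frac_eq)
      finally show ?thesis .
    qed
    have f0: "1 / (u (w t) - A 0) * ((\<beta> - cnj \<beta>) / ?v\<^sup>2) = 1 / w t - 1 / ?v"
      "1 / (u (w t) - A 1) * ((\<beta> - cnj \<beta>) / ?v\<^sup>2) = 1 / (w t - 1) - 1 / ?v"
      "1 / (u (w t) - A (- 1)) * ((\<beta> - cnj \<beta>) / ?v\<^sup>2) = 1 / (w t + 1) - 1 / ?v"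
      using fA[of 0] fA[of 1] fA[of "- 1"] w0 w1 \<open>w t + 1 \<noteq> 0\<close> by simp_all
    fix j :: nat assume "j > 0"
    consider "j = 1" | "j = 2" | "j > 2" using \<open>j > 0\<close> by linarith
    then show "S_form j (w t) = log_form (L j) (u (w t)) * ((\<beta> - cnj \<beta>) / ?v\<^sup>2)"
    proof cases
      case 1
      have eq: "log_form (L j) (u (w t)) = 1 / (u (w t) - A 0) - 1 / (u (w t) - 1)"
        by (simp add: log_form_def L_def 1)
      show ?thesis unfolding eq left_diff_distrib f0 f1 by (simp add: S_form_def 1)
    next
      case 2
      have eq: "log_form (L j) (u (w t)) = 1 / (u (w t) - A 1) - 1 / (u (w t) - A (- 1))"
        by (simp add: log_form_def L_def 2)
      show ?thesis unfolding eq left_diff_distrib f0 f1 by (simp add: S_form_def 2)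
    next
      case 3
      have eq: "log_form (L j) (u (w t)) = 1 / (u (w t) - A 1) + 1 / (u (w t) - A (- 1)) - 1 / (u (w t) - A 0) - 1 / (u (w t) - 1)"
        using 3 by (simp add: log_form_def L_def)
      show ?thesis unfolding eq left_diff_distrib distrib_right f0 f1 using 3 by (simp add: S_form_def)
    qed
  next
    show "complex_of_real a \<notin> \<real>\<^sub>\<le>\<^sub>0" using a by (simp add: complex_nonpos_Reals_iff)
    have "\<bar>a\<^sup>2 - 1\<bar> \<le> 2 * a"
    proof -
      have "a\<^sup>2 \<le> 1" using a by (intro power_le_one) auto
      then show ?thesis using a by simp
    qed
    then show "norm (sinh_Ln (complex_of_real a)) \<le> 1" using a by (intro norm_hh_le) auto
    have "(u \<longlongrightarrow> u (of_real r)) (at (of_real r))" for r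
      unfolding u_def[abs_def] using nzr by (intro tendsto_intros)
    then have cont: "isCont u (of_real r)" for r by (simp add: isCont_def)
    show "((\<lambda>t. u (w t)) \<longlongrightarrow> A a) (at_right 0)" "((\<lambda>t. u (w t)) \<longlongrightarrow> A 1) (at_left 1)"
      using isCont_tendsto_compose[OF cont w_lim(1)]
        isCont_tendsto_compose[OF cont[of 1], unfolded of_real_1, OF w_lim(2)]
      by (simp_all add: uA uA[of 1, unfolded of_real_1])
    show "A a ^ N = 1" "A 1 ^ N = 1" by fact+
    show "\<And>j b. j > 0 \<Longrightarrow> b \<in> snd ` set (L j) \<Longrightarrow> b = 0 \<and> False \<or> b ^ N = 1 \<and> b \<noteq> A a"
      using A inj[of _ a] A1[of a] a by (auto simp: L_def split: if_splits)
    show "\<And>b. b \<in> snd ` set (L 1) \<Longrightarrow> b \<noteq> A 1"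
      using inj[of 0 1] A1[of 1] by (auto simp: L_def)
    \<comment> \<open>For t \<ge> 1/2 the identity \<open>norm_u\<close> gives 1 - |u| \<ge> (1 - t)
      Im \<beta> / B^2, and |w - 1| \<le> 2 (1 - t).\<close>
    show "\<forall>\<^sub>F t in at_left 1. norm (w t - 1) \<le> 2 * B\<^sup>2 / Im \<beta> * (1 - norm (u (w t)))"
      using eventually_at_left_real[of "1 / 2" "1 :: real", simplified]
    proof eventually_elim
      case (elim t)
      then have t: "t \<in> {0<..<1}" "t \<ge> 1 / 2" by auto
      note bd = bd[OF t(1)]
      have "norm (w t - cnj \<beta>) \<le> norm (w t) + norm \<beta>" using norm_triangle_ineq4[of "w t" "cnj \<beta>"] by simp
      also have "norm (w t) \<le> 2" using cmod_le[of "w t"] bd a by simp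
      finally have nB: "norm (w t - cnj \<beta>) \<le> B" by (simp add: B_def)
      have "(1 - t) / 2 \<le> Im (w t)"
        unfolding Iw using mult_right_mono[OF t(2), of "1 - t"] t(1) by simp
      then have "2 * (1 - t) * Im \<beta> / B\<^sup>2 \<le> 4 * Im (w t) * Im \<beta> / B\<^sup>2"
        using \<beta> by (intro divide_right_mono mult_right_mono) auto
      also have "\<dots> \<le> 4 * Im (w t) * Im \<beta> / (norm (w t - cnj \<beta>))\<^sup>2"
        using bd \<beta> nB nz[OF t(1)] by (intro divide_left_mono power_mono mult_pos_pos) (auto simp: B_def add_pos_nonneg)
      also have "\<dots> = (1 - norm (u (w t))) * (1 + norm (u (w t)))"
        unfolding norm_u[OF t(1), symmetric] by (simp add: power2_eq_square algebra_simps)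
      also have "\<dots> \<le> (1 - norm (u (w t))) * 2" using nlt[OF t(1)] by (intro mult_left_mono) auto
      finally have "2 * (1 - t) * Im \<beta> / B\<^sup>2 \<le> (1 - norm (u (w t))) * 2" .
      moreover have "x \<le> y" if "2 * x \<le> y * 2" for x y :: real using that by simp
      ultimately have "(1 - t) * Im \<beta> / B\<^sup>2 \<le> 1 - norm (u (w t))" by (simp only: mult.assoc times_divide_eq_right)
      moreover have "B > 0" by (simp add: B_def add_pos_nonneg)
      ultimately have "1 - t \<le> B\<^sup>2 / Im \<beta> * (1 - norm (u (w t)))"
        using \<beta> by (simp add: field_simps)
      moreover have "norm (w t - 1) \<le> 2 * (1 - t)"
      proof -
        have "norm (w t - 1) \<le> \<bar>Re (w t - 1)\<bar> + \<bar>Im (w t - 1)\<bar>" by (rule cmod_le)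
        also have "\<dots> = (1 - t) * (1 - a) + t * (1 - t)"
          using bd by (simp add: Rw Iw algebra_simps)
        also have "\<dots> \<le> (1 - t) * 1 + 1 * (1 - t)" using t(1) a by (intro add_mono mult_left_mono mult_right_mono) auto
        finally show ?thesis by simp
      qed
      ultimately show ?case by simp
    qed
  qed (use w_lim in auto)
qed

section \<open>The special arguments\<close>

text \<open>A = z / cnj z has modulus 1, so it is a root of the quadratic with c = A + 1 / A = 2 Re
  A.\<close>

lemma conj_quotient_quadratic:
  fixes z :: complex and c :: real
  assumes "z \<noteq> 0" "c * ((Re z)\<^sup>2 + (Im z)\<^sup>2) = 2 * ((Re z)\<^sup>2 - (Im z)\<^sup>2)"
  shows "(z / cnj z)\<^sup>2 = of_real c * (z / cnj z) - 1"
proof -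
  have "of_real ((Re z)\<^sup>2 + (Im z)\<^sup>2) = z * cnj z" by (simp add: complex_mult_cnj)
  moreover have "of_real (2 * ((Re z)\<^sup>2 - (Im z)\<^sup>2)) = z\<^sup>2 + (cnj z)\<^sup>2"
    by (simp add: complex_eq_iff power2_eq_square)
  ultimately have "of_real c * (z * cnj z) = z\<^sup>2 + (cnj z)\<^sup>2"
    using arg_cong[OF assms(2), of complex_of_real] by (simp only: of_real_mult)
  then show ?thesis using assms(1) by (simp add: field_simps power2_eq_square)
qed

text \<open>For A = cis \<phi> one has c = 2 cos \<phi>. The conditions are the equations of this
  number for the orders 4; 3 and 6; 8; 10; 5; and 2.\<close>

lemma power_from_quadratic:
  fixes A c :: complex
  assumes A: "A\<^sup>2 = c * A - 1"
  shows "c = 0 \<Longrightarrow> A ^ 4 = 1"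
    and "c\<^sup>2 = 1 \<Longrightarrow> A ^ 6 = 1"
    and "c\<^sup>2 = 2 \<Longrightarrow> A ^ 8 = 1"
    and "c\<^sup>2 - c = 1 \<Longrightarrow> A ^ 10 = 1"
    and "c\<^sup>2 + c = 1 \<Longrightarrow> A ^ 10 = 1"
    and "c = - 2 \<Longrightarrow> A = - 1"
proof -
  show "A ^ 4 = 1" if "c = 0" using A that by algebra
  show "A ^ 6 = 1" if "c\<^sup>2 = 1" using A that by algebra
  show "A ^ 8 = 1" if "c\<^sup>2 = 2" using A that by algebra
  show "A ^ 10 = 1" if "c\<^sup>2 - c = 1"
  proof -
    have "A ^ 5 = - 1" using A that by algebra
    then show ?thesis by algebra
  qed
  show "A ^ 10 = 1" if "c\<^sup>2 + c = 1"
  proof -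
    have "A ^ 5 = 1" using A that by algebra
    then show ?thesis by algebra
  qed
  show "A = - 1" if "c = - 2"
  proof -
    have "(A + 1)\<^sup>2 = 0" using A that by algebra
    then show ?thesis by (simp add: add_eq_0_iff2)
  qed
qed

lemma real_argument:
  fixes a :: real
  assumes "k \<ge> 2" "S_chain k (of_real a) \<in> CMZV k N"
  shows "of_real ((a - 1 / a) / 2) * S_series k (of_real (- (a - 1 / a)\<^sup>2)) \<in> CMZV k N"
proof -
  have h: "sinh_Ln (of_real a) = of_real ((a - 1 / a) / 2)" by (simp add: sinh_Ln_def)
  have "- 4 * (sinh_Ln (of_real a))\<^sup>2 = of_real (- (a - 1 / a)\<^sup>2)"
    unfolding h of_real_minus of_real_power of_real_divide by (simp add: power_divide)
  moreover have "S_chain k (of_real a) = odd_S k (sinh_Ln (of_real a))" using assms(1) by (simp add: S_chain_def)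
  ultimately show ?thesis using assms(2) by (simp only: odd_S_def h)
qed

text \<open>Here \<open>c = A + 1 / A\<close> for a prospective \<open>N\<close>-th root of unity \<open>A\<close>.\<close>

definition root_trace :: "real \<Rightarrow> nat \<Rightarrow> bool" where
  "root_trace c N \<longleftrightarrow> c = - 2 \<and> 2 dvd N \<or> c = 0 \<and> 4 dvd N \<or> c\<^sup>2 = 1 \<and> 6 dvd N \<or> c\<^sup>2 = 2 \<and> 8 dvd N
      \<or> (c\<^sup>2 - c = 1 \<or> c\<^sup>2 + c = 1) \<and> 10 dvd N"

lemma root_trace_power_one:
  fixes A :: complex
  assumes A: "A\<^sup>2 = of_real c * A - 1" and N: "root_trace c N"
  shows "A ^ N = 1"
proof -
  have pow: "A ^ N = 1" if "A ^ m = 1" "m dvd N" for m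
    using that by (auto simp: power_mult elim!: dvdE)
  from N show ?thesis
    unfolding root_trace_def
  proof (elim disjE conjE)
    assume "c = - 2" "2 dvd N"
    then show ?thesis using power_from_quadratic(6)[OF A] by (intro pow[of 2]) auto
  next
    assume "c = 0" "4 dvd N"
    then show ?thesis using power_from_quadratic(1)[OF A] by (intro pow[of 4]) auto
  next
    assume h: "c\<^sup>2 = 1" "6 dvd N"
    show ?thesis
      using power_from_quadratic(2)[OF A] arg_cong[OF h(1), of complex_of_real] h(2)
      by (intro pow[of 6]) simp_all
  next
    assume h: "c\<^sup>2 = 2" "8 dvd N"
    show ?thesis
      using power_from_quadratic(3)[OF A] arg_cong[OF h(1), of complex_of_real] h(2)
      by (intro pow[of 8]) simp_all
  next
    assume h: "c\<^sup>2 - c = 1" "10 dvd N"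
    show ?thesis
      using power_from_quadratic(4)[OF A] arg_cong[OF h(1), of complex_of_real] h(2)
      by (intro pow[of 10]) simp_all
  next
    assume h: "c\<^sup>2 + c = 1" "10 dvd N"
    show ?thesis
      using power_from_quadratic(5)[OF A] arg_cong[OF h(1), of complex_of_real] h(2)
      by (intro pow[of 10]) simp_all
  qed
qed

text \<open>Here \<beta> = p + \<i> sqrt r, and c0, c1, c2, c3 are the values of A + 1 / A at 0, 1,
  -1, a. Using the squared imaginary part r keeps all conditions polynomial, so an instance is plain
  arithmetic. The number d is a - 1 / a, and q adjusts the prefactor.\<close>

lemma S_series_real_argument:
  fixes a d p r q :: real
  assumes k: "k \<ge> 2" and N: "N > 0" and a: "0 < a" "a < 1" "1 \<le> a\<^sup>2 + 2 * a" and r: "r > 0"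
    and c: "c0 * (p\<^sup>2 + r) = 2 * (p\<^sup>2 - r)" "c1 * ((1 - p)\<^sup>2 + r) = 2 * ((1 - p)\<^sup>2 - r)"
      "c2 * ((- 1 - p)\<^sup>2 + r) = 2 * ((- 1 - p)\<^sup>2 - r)" "c3 * ((a - p)\<^sup>2 + r) = 2 * ((a - p)\<^sup>2 - r)"
    and root: "root_trace c0 N" "root_trace c1 N" "root_trace c2 N" "root_trace c3 N"
    and d: "a\<^sup>2 - 1 = d * a" and q: "q \<in> \<rat>"
  shows "of_real (q * d) * S_series k (of_real (- d\<^sup>2)) \<in> CMZV k N"
proof -
  define \<beta> where "\<beta> = Complex p (sqrt r)"
  have \<beta>: "Im \<beta> > 0" using r by (simp add: \<beta>_def)
  have A: "((of_real x - \<beta>) / (of_real x - cnj \<beta>)) ^ N = 1"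
    if "c * ((x - p)\<^sup>2 + r) = 2 * ((x - p)\<^sup>2 - r)" "root_trace c N" for c x
  proof -
    have "of_real x - \<beta> \<noteq> 0" using \<beta> by (auto simp: complex_eq_iff)
    then have "((of_real x - \<beta>) / cnj (of_real x - \<beta>))\<^sup>2 = of_real c * ((of_real x - \<beta>) / cnj (of_real x - \<beta>)) - 1"
      using that(1) r by (intro conj_quotient_quadratic) (simp_all add: \<beta>_def)
    from root_trace_power_one[OF this that(2)] show ?thesis by simp
  qed
  have "S_chain k (of_real a) \<in> CMZV k N"
    using A[of c0 0] A[of c1 1] A[of c2 "- 1"] A[of c3 a] c root by (intro S_chain_real_CMZV[of N a \<beta>] N a \<beta>) auto
  moreover have d': "d = a - 1 / a" using d a by (simp add: field_simps power2_eq_square)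
  ultimately have "of_real (d / 2) * S_series k (of_real (- d\<^sup>2)) \<in> CMZV k N"
    unfolding d' by (intro real_argument[OF k])
  moreover obtain i j :: int where "q = of_int i / of_int j"
    using q by (auto simp: Rats_eq_int_div_int)
  then have "complex_of_real (2 * q) \<in> \<rat>" by simp
  ultimately have "of_real (2 * q) * (of_real (d / 2) * S_series k (of_real (- d\<^sup>2))) \<in> CMZV k N"
    by (rule CMZV_Rats_mult[rotated])
  moreover have "complex_of_real (2 * q) * of_real (d / 2) = of_real (q * d)"
    unfolding of_real_mult[symmetric] by simp
  ultimately show ?thesis by (simp only: mult.assoc[symmetric])
qed

text \<open>\<beta> = cis (pi / 3) lies above a = 1/2. The points 0, 1, -1, a go to roots of unity
  of orders 3, 3, 6, 2.\<close>

lemma S_minus_9_4: "k \<ge> 2 \<Longrightarrow> S_series k (- 9 / 4) \<in> CMZV k 6"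
  using S_series_real_argument[of k 6 "1 / 2" "3 / 4" "- 1" "1 / 2" "- 1" 1 "- 2" "- 3 / 2" "- 2 / 3"]
  by (simp add: power2_eq_square root_trace_def)

text \<open>For \<beta> = \<i> the point tan \<phi> goes to - cis (2 \<phi>), and a = tan (pi / 8).
  This argument lies on the circle of convergence.\<close>

lemma S_minus_4: "k \<ge> 2 \<Longrightarrow> S_series k (- 4) \<in> CMZV k 8"
proof -
  assume k: "k \<ge> 2"
  define s :: real where "s = sqrt 2"
  have s: "s * s = 2" "1 < s" "s < 2" by (auto simp: s_def intro: real_less_rsqrt real_sqrt_less_iff[THEN iffD2] sqrt2_less_2)
  have "of_real (- 1 / 2 * - 2) * S_series k (of_real (- (- 2)\<^sup>2)) \<in> CMZV k 8"
    by (rule S_series_real_argument[OF k, of 8 "s - 1" 1 "- 2" 0 0 0 "- s"])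
      (use s in \<open>simp_all add: root_trace_def power2_eq_square algebra_simps\<close>)
  then show ?thesis by simp
qed

text \<open>\<beta> = cis (pi / 4) lies above a, so a goes to -1, while 0 has an image of order 4
  and 1, -1 have images of order 8.\<close>

lemma S_minus_1_2: "k \<ge> 2 \<Longrightarrow> of_real (sqrt 2) * S_series k (- 1 / 2) \<in> CMZV k 8"
proof -
  assume k: "k \<ge> 2"
  define s :: real where "s = sqrt 2"
  have s: "s * s = 2" "1 < s" "s < 2" by (auto simp: s_def intro: real_less_rsqrt sqrt2_less_2)
  have "of_real (- 2 * (- s / 2)) * S_series k (of_real (- (- s / 2)\<^sup>2)) \<in> CMZV k 8"
    by (rule S_series_real_argument[OF k, of 8 "s / 2" "1 / 2" 0 "s / 2" "- s" s "- 2"])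
      (use s in \<open>simp_all add: root_trace_def power2_eq_square algebra_simps\<close>)
  moreover have "- (- s / 2)\<^sup>2 = - 1 / 2" using s by (simp add: power2_eq_square)
  ultimately show ?thesis by (simp only:) (simp add: s_def)
qed

text \<open>\<beta> = cis (2 pi / 5), and a = 2 Re \<beta> is the mirror image of 0 in the vertical
  line through \<beta>, whence c3 = c0.\<close>

lemma S_minus_1: "k \<ge> 2 \<Longrightarrow> S_series k (- 1) \<in> CMZV k 10"
proof -
  assume k: "k \<ge> 2"
  define s :: real where "s = sqrt 5"
  have s: "s * s = 5" "2 < s" "s < 3" by (auto simp: s_def intro: real_less_rsqrt real_less_lsqrt)
  have "of_real (- 1 * - 1) * S_series k (of_real (- (- 1)\<^sup>2)) \<in> CMZV k 10"
    by (rule S_series_real_argument[OF k, of 10 "(s - 1) / 2" "(10 + 2 * s) / 16" "- (1 + s) / 2" "(s - 1) / 4"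
          "(1 - s) / 2" "(s - 1) / 2" "- (1 + s) / 2"])
      (use s in \<open>simp_all add: root_trace_def power2_eq_square field_simps\<close>)
  then show ?thesis by simp
qed

text \<open>\<beta> = \<i> cot (pi / 5). In units of Im \<beta> the points 1 and a are tan (pi / 5)
  and tan (pi / 10), with images - cis (2 pi / 5) and - cis (pi / 5).\<close>

lemma S_minus_16_5: "k \<ge> 2 \<Longrightarrow> of_real (sqrt 5) * S_series k (- 16 / 5) \<in> CMZV k 10"
proof -
  assume k: "k \<ge> 2"
  define s :: real where "s = sqrt 5"
  have s: "s * s = 5" "2 < s" "s < 3" by (auto simp: s_def intro: real_less_rsqrt real_less_lsqrt)
  have "of_real (- 5 / 4 * (- 4 * s / 5)) * S_series k (of_real (- (- 4 * s / 5)\<^sup>2)) \<in> CMZV k 10"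
    by (rule S_series_real_argument[OF k, of 10 "s / 5" "1 + 2 * s / 5" "- 2" 0
          "(1 - s) / 2" "(1 - s) / 2" "- (1 + s) / 2"])
      (use s in \<open>simp_all add: root_trace_def power2_eq_square field_simps\<close>)
  moreover have "- (- 4 * s / 5)\<^sup>2 = - 16 / 5" using s by (simp add: power2_eq_square)
  ultimately show ?thesis by (simp only:) (simp add: s_def)
qed

text \<open>Again \<beta> = \<i>; now a = tan (pi / 6) has an image of order 3, which together with
  the images of 1 and -1, of order 4, forces level 12.\<close>

lemma S_minus_4_3: "k \<ge> 2 \<Longrightarrow> of_real (sqrt 3) * S_series k (- 4 / 3) \<in> CMZV k 12"
proof -
  assume k: "k \<ge> 2"
  define s :: real where "s = sqrt 3"
  have s: "s * s = 3" "1 < s" "s < 2" by (auto simp: s_def intro: real_less_rsqrt real_less_lsqrt)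
  have "of_real (- 3 / 2 * (- 2 * s / 3)) * S_series k (of_real (- (- 2 * s / 3)\<^sup>2)) \<in> CMZV k 12"
    by (rule S_series_real_argument[OF k, of 12 "s / 3" 1 "- 2" 0 0 0 "- 1"])
      (use s in \<open>simp_all add: root_trace_def power2_eq_square field_simps\<close>)
  moreover have "- (- 2 * s / 3)\<^sup>2 = - 4 / 3" using s by (simp add: power2_eq_square)
  ultimately show ?thesis by (simp only:) (simp add: s_def)
qed

text \<open>On the unit circle 1 / w is cnj w, so \<open>sinh_Ln\<close> is \<i> times the sine;
  this is the source of the factor \<i>.\<close>

lemma S_four_sin_squared:
  fixes \<theta> :: real
  assumes k: "k \<ge> 2" and M: "M > 0" "2 dvd M" and \<theta>: "cis \<theta> ^ M = 1"
  shows "S_series k (of_real (4 * (sin \<theta>)\<^sup>2)) * of_real (sin \<theta>) \<in> (\<lambda>x. \<i> * x) ` CMZV k M"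
proof (cases "sin \<theta> = 0")
  case True
  then show ?thesis using CMZV_zero by force
next
  case False
  \<comment> \<open>Replacing \<theta> by pi - \<theta> keeps the sine and makes the real part
    nonnegative; w0 remains an M-th root of unity because M is even.\<close>
  define w0 where "w0 = (if cos \<theta> \<ge> 0 then cis \<theta> else - cnj (cis \<theta>))"
  have w0: "Re w0 \<ge> 0" "Im w0 = sin \<theta>" "norm w0 = 1" by (auto simp: w0_def)
  have m1: "(- 1 :: complex) ^ M = 1" using M by (auto elim: dvdE)
  have "(- cnj (cis \<theta>)) ^ M = (- 1) ^ M * cnj (cis \<theta> ^ M)"
    by (subst power_minus) (simp only: complex_cnj_power)
  then have "w0 ^ M = 1" using \<theta> m1 by (simp add: w0_def)
  then have S_chain: "S_chain k w0 \<in> CMZV k M"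
    using w0 False M m1 by (intro S_chain_root_CMZV) auto
  have "w0 * cnj w0 = 1" using complex_norm_square[of w0] w0(3) by simp
  moreover have "w0 \<noteq> 0" using w0(3) by auto
  ultimately have "1 / w0 = cnj w0" by (simp add: field_simps)
  then have h: "sinh_Ln w0 = \<i> * of_real (sin \<theta>)" by (simp add: sinh_Ln_def complex_eq_iff w0(2))
  have "S_chain k w0 = \<i> * of_real (sin \<theta>) * S_series k (of_real (4 * (sin \<theta>)\<^sup>2))"
    using k by (simp add: S_chain_def odd_S_def h power_mult_distrib)
  then have "S_series k (of_real (4 * (sin \<theta>)\<^sup>2)) * of_real (sin \<theta>) = \<i> * (- S_chain k w0)"
    by (simp add: mult_ac)
  then show ?thesis using CMZV_minus[OF S_chain] by blast
qed

theorem theorem4: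
  shows "(\<forall>(k::nat) (N::nat) (m::int). k \<ge> 2 \<longrightarrow> N \<ge> 3 \<longrightarrow>
            S_series k (complex_of_real (4 * (sin (2 * of_int m * pi / real N))^2))
              * complex_of_real (sin (2 * of_int m * pi / real N))
            \<in> (\<lambda>x. \<i> * x) ` CMZV k (lcm 2 N))
       \<and> (\<forall>k::nat. k \<ge> 2 \<longrightarrow>
            S_series k (- 9 / 4) \<in> CMZV k 6 \<and>
            S_series k (- 4) \<in> CMZV k 8 \<and>
            complex_of_real (sqrt 2) * S_series k (- 1 / 2) \<in> CMZV k 8 \<and>
            S_series k (- 1) \<in> CMZV k 10 \<and>
            complex_of_real (sqrt 5) * S_series k (- 16 / 5) \<in> CMZV k 10 \<and>
            complex_of_real (sqrt 3) * S_series k (- 4 / 3) \<in> CMZV k 12)"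
proof (intro conjI allI impI)
  fix k N :: nat and m :: int
  assume k: "k \<ge> 2" and N: "N \<ge> 3"
  let ?\<theta> = "2 * of_int m * pi / real N"
  have "cis ?\<theta> ^ N = cis (real N * ?\<theta>)" by (rule Complex.DeMoivre)
  also have "real N * ?\<theta> = 2 * pi * of_int m" using N by simp
  also have "cis (2 * pi * of_int m) = 1" by (rule cis_multiple_2pi) simp
  finally have 1: "cis ?\<theta> ^ N = 1" .
  obtain c where "lcm 2 N = N * c" using dvd_lcm2[of N 2] by (elim dvdE)
  then have "cis ?\<theta> ^ lcm 2 N = 1" by (simp only: power_mult 1 power_one)
  then show "S_series k (complex_of_real (4 * (sin ?\<theta>)^2)) * complex_of_real (sin ?\<theta>)
      \<in> (\<lambda>x. \<i> * x) ` CMZV k (lcm 2 N)"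
    using N by (intro S_four_sin_squared k) (auto intro: lcm_pos_nat)
qed (erule S_minus_9_4 S_minus_4 S_minus_1_2 S_minus_1 S_minus_16_5 S_minus_4_3)+

end
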